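(* The class $\mathcal{AF}$ of additionally free arrangements is not closed under taking restrictions: there exist an additionally free arrangement $\mathcal{A}$ and an element $X\in L(\mathcal{A})$ such that the restriction $\mathcal{A}^X$ is not additionally free.
   Context: Let $\mathbb{K}$ be a field and $V=\mathbb{K}^\ell$, $\ell\ge 0$. An arrangement $\mathcal{A}$ in $V$ is a finite set of hyperplanes in $V$; all arrangements are central, i.e. all hyperplanes contain $0$. The class $\mathcal{AF}$ consists of arrangements in $\mathbb{K}^\ell$ for arbitrary fields $\mathbb{K}$ and arbitrary $\ell\ge 0$. $\Phi_\ell$ denotes the empty arrangement in $\mathbb{K}^\ell$. $L(\mathcal{A})$ is the set of all intersections of elements of $\mathcal{A}$ (including $V$ as the empty intersection). For $X\in L(\mathcal{A})$ put $\mathcal{A}_X=\{H\in\mathcal{A}\mid X\subseteq H\}$; the restriction of $\mathcal{A}$ to $X$ is the arrangement $\mathcal{A}^X=\{X\cap H\mid H\in\mathcal{A}\setminus\mathcal{A}_X\}$ in the vector space $X$. Freeness. Let $S=S(V^* )$ be the symmetric algebra of $V^*$, choose $\alpha_H\in V^*$ with $H=\ker\alpha_H$ for each $H\in\mathcal{A}$, and let $Q(\mathcal{A})=\prod_{H\in\mathcal{A}}\alpha_H$. Let $D(\mathcal{A})=\{\theta\in\mathrm{Der}(S)\mid\theta(Q(\mathcal{A}))\in Q(\mathcal{A})S\}$, where $\mathrm{Der}(S)$ is the $S$-module of $\mathbb{K}$-derivations of $S$. $\mathcal{A}$ is free if $D(\mathcal{A})$ is a free $S$-module. Additionally free: an arrangement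 $\mathcal{A}$ in $\mathbb{K}^\ell$ with $|\mathcal{A}|=n$ is additionally free (belongs to $\mathcal{AF}$) if there is a filtration $\Phi_\ell=\mathcal{A}_0\subset\mathcal{A}_1\subset\cdots\subset\mathcal{A}_n=\mathcal{A}$ where each $\mathcal{A}_i$ is free and $|\mathcal{A}_i|=i$. *)

theory Defs
  imports Complex_Main "HOL-Algebra.Algebra"
begin

text \<open>Fields are records in the sense of HOL-Algebra, so that a statement may quantify over
  them. Up to isomorphism, the fields with elements of type \<^typ>\<open>complex\<close>, with arbitrary
  carrier and operations, are all fields of at most continuum cardinality, of any
  characteristic.\<close>

section \<open>Coordinate spaces and central arrangements\<close>

text \<open>The vector space \<open>K\<^sup>l\<close>. The record type of modules extends that of rings; its
  fields \<open>mult\<close> and \<open>one\<close> have no meaning for a module.\<close>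

definition coord_space :: "'a ring \<Rightarrow> nat \<Rightarrow> ('a, nat \<Rightarrow> 'a) module" where
  "coord_space K l =
     \<lparr>carrier = {..<l} \<rightarrow>\<^sub>E carrier K,
      monoid.mult = undefined, monoid.one = undefined,
      ring.zero = (\<lambda>i\<in>{..<l}. \<zero>\<^bsub>K\<^esub>),
      ring.add = (\<lambda>u v. \<lambda>i\<in>{..<l}. u i \<oplus>\<^bsub>K\<^esub> v i),
      smult = (\<lambda>c v. \<lambda>i\<in>{..<l}. c \<otimes>\<^bsub>K\<^esub> v i)\<rparr>"

text \<open>A linear form on \<open>K\<^sup>l\<close> is given by its coefficient vector with respect to the
  coordinate functions.\<close>

definition form_kernel :: "'a ring \<Rightarrow> nat \<Rightarrow> (nat \<Rightarrow> 'a) \<Rightarrow> (nat \<Rightarrow> 'a) set" where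
  "form_kernel K l a =
     {v \<in> carrier (coord_space K l). (\<Oplus>\<^bsub>K\<^esub> i\<in>{..<l}. a i \<otimes>\<^bsub>K\<^esub> v i) = \<zero>\<^bsub>K\<^esub>}"

definition defines_hyperplane ::
    "'a ring \<Rightarrow> nat \<Rightarrow> (nat \<Rightarrow> 'a) \<Rightarrow> (nat \<Rightarrow> 'a) set \<Rightarrow> bool" where
  "defines_hyperplane K l a H \<longleftrightarrow>
     a \<in> carrier (coord_space K l) \<and> a \<noteq> \<zero>\<^bsub>coord_space K l\<^esub> \<and> H = form_kernel K l a"

definition arrangement :: "'a ring \<Rightarrow> nat \<Rightarrow> (nat \<Rightarrow> 'a) set set \<Rightarrow> bool" where
  "arrangement K l A \<longleftrightarrow> finite A \<and> (\<forall>H\<in>A. \<exists>a. defines_hyperplane K l a H)"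

definition intersection_lattice ::
    "'a ring \<Rightarrow> nat \<Rightarrow> (nat \<Rightarrow> 'a) set set \<Rightarrow> (nat \<Rightarrow> 'a) set set" where
  "intersection_lattice K l A = {carrier (coord_space K l) \<inter> \<Inter>B | B. B \<subseteq> A}"

definition localization :: "'v set set \<Rightarrow> 'v set \<Rightarrow> 'v set set" where
  "localization A Y = {H \<in> A. Y \<subseteq> H}"

definition restriction :: "'v set set \<Rightarrow> 'v set \<Rightarrow> 'v set set" where
  "restriction A Y = {Y \<inter> H | H. H \<in> A - localization A Y}"

section \<open>The symmetric algebra and its derivations\<close>

text \<open>The symmetric algebra of the dual of \<open>K\<^sup>l\<close> is the polynomial ring over \<open>K\<close> in the
  coordinate functions, indexed by the numbers below \<open>l\<close>. Monomials are multisets of indices,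
  as in \<^theory>\<open>HOL-Algebra.Indexed_Polynomials\<close>.\<close>

definition sym_algebra :: "'a ring \<Rightarrow> nat \<Rightarrow> (nat multiset \<Rightarrow> 'a) ring" where
  "sym_algebra K l =
     \<lparr>carrier = ring.indexed_pset K {..<l} (carrier K),
      monoid.mult = (\<lambda>p q m. \<Oplus>\<^bsub>K\<^esub> n\<in>{n. n \<subseteq># m}. p n \<otimes>\<^bsub>K\<^esub> q (m - n)),
      monoid.one = ring.indexed_const K \<one>\<^bsub>K\<^esub>,
      ring.zero = ring.indexed_const K \<zero>\<^bsub>K\<^esub>,
      ring.add = ring.indexed_padd K\<rparr>"

definition linear_poly :: "'a ring \<Rightarrow> nat \<Rightarrow> (nat \<Rightarrow> 'a) \<Rightarrow> (nat multiset \<Rightarrow> 'a)" where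
  "linear_poly K l a =
     (\<Oplus>\<^bsub>sym_algebra K l\<^esub> i\<in>{..<l}.
        ring.indexed_const K (a i) \<otimes>\<^bsub>sym_algebra K l\<^esub> ring.indexed_var K i)"

text \<open>The linear form chosen for a hyperplane is unique up to a nonzero scalar, hence so is the
  defining polynomial, and the module of logarithmic derivations does not depend on the
  choices.\<close>

definition chosen_form :: "'a ring \<Rightarrow> nat \<Rightarrow> (nat \<Rightarrow> 'a) set \<Rightarrow> (nat \<Rightarrow> 'a)" where
  "chosen_form K l H = (SOME a. defines_hyperplane K l a H)"

definition defining_poly ::
    "'a ring \<Rightarrow> nat \<Rightarrow> (nat \<Rightarrow> 'a) set set \<Rightarrow> (nat multiset \<Rightarrow> 'a)" where
  "defining_poly K l A =
     (\<Otimes>\<^bsub>sym_algebra K l\<^esub> H\<in>A. linear_poly K l (chosen_form K l H))"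

definition derivations ::
    "'a ring \<Rightarrow> nat \<Rightarrow> ((nat multiset \<Rightarrow> 'a) \<Rightarrow> (nat multiset \<Rightarrow> 'a)) set" where
  "derivations K l = (let S = sym_algebra K l in
     {\<theta> \<in> carrier S \<rightarrow>\<^sub>E carrier S.
        (\<forall>f\<in>carrier S. \<forall>g\<in>carrier S. \<theta> (f \<oplus>\<^bsub>S\<^esub> g) = \<theta> f \<oplus>\<^bsub>S\<^esub> \<theta> g) \<and>
        (\<forall>c\<in>carrier K. \<forall>f\<in>carrier S.
           \<theta> (ring.indexed_const K c \<otimes>\<^bsub>S\<^esub> f) = ring.indexed_const K c \<otimes>\<^bsub>S\<^esub> \<theta> f) \<and>
        (\<forall>f\<in>carrier S. \<forall>g\<in>carrier S.
           \<theta> (f \<otimes>\<^bsub>S\<^esub> g) = (f \<otimes>\<^bsub>S\<^esub> \<theta> g) \<oplus>\<^bsub>S\<^esub> (\<theta> f \<otimes>\<^bsub>S\<^esub> g))})"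

definition Der ::
    "'a ring \<Rightarrow> nat \<Rightarrow>
       (nat multiset \<Rightarrow> 'a, (nat multiset \<Rightarrow> 'a) \<Rightarrow> (nat multiset \<Rightarrow> 'a)) module" where
  "Der K l = (let S = sym_algebra K l in
     \<lparr>carrier = derivations K l,
      monoid.mult = undefined, monoid.one = undefined,
      ring.zero = (\<lambda>f\<in>carrier S. \<zero>\<^bsub>S\<^esub>),
      ring.add = (\<lambda>\<theta> \<eta>. \<lambda>f\<in>carrier S. \<theta> f \<oplus>\<^bsub>S\<^esub> \<eta> f),
      smult = (\<lambda>p \<theta>. \<lambda>f\<in>carrier S. p \<otimes>\<^bsub>S\<^esub> \<theta> f)\<rparr>)"

definition log_derivations ::
    "'a ring \<Rightarrow> nat \<Rightarrow> (nat \<Rightarrow> 'a) set set \<Rightarrow>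
       (nat multiset \<Rightarrow> 'a, (nat multiset \<Rightarrow> 'a) \<Rightarrow> (nat multiset \<Rightarrow> 'a)) module" where
  "log_derivations K l A = (Der K l)
     \<lparr>carrier := {\<theta> \<in> derivations K l.
        \<theta> (defining_poly K l A) \<in> PIdl\<^bsub>sym_algebra K l\<^esub> (defining_poly K l A)}\<rparr>"

section \<open>Free and additionally free arrangements\<close>

definition free_module :: "('r, 'm) ring_scheme \<Rightarrow> ('r, 'b, 'n) module_scheme \<Rightarrow> bool" where
  "free_module R M \<longleftrightarrow>
     (\<exists>B\<subseteq>carrier M. \<forall>x\<in>carrier M. \<exists>!c.
        c \<in> B \<rightarrow>\<^sub>E carrier R \<and> finite {b \<in> B. c b \<noteq> \<zero>\<^bsub>R\<^esub>} \<and>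
        x = (\<Oplus>\<^bsub>M\<^esub> b\<in>{b \<in> B. c b \<noteq> \<zero>\<^bsub>R\<^esub>}. c b \<odot>\<^bsub>M\<^esub> b))"

definition free_arrangement :: "'a ring \<Rightarrow> nat \<Rightarrow> (nat \<Rightarrow> 'a) set set \<Rightarrow> bool" where
  "free_arrangement K l A \<longleftrightarrow>
     arrangement K l A \<and> free_module (sym_algebra K l) (log_derivations K l A)"

definition additionally_free :: "'a ring \<Rightarrow> nat \<Rightarrow> (nat \<Rightarrow> 'a) set set \<Rightarrow> bool" where
  "additionally_free K l A \<longleftrightarrow>
     arrangement K l A \<and>
     (\<exists>F. F 0 = {} \<and> F (card A) = A \<and>
        (\<forall>i<card A. F i \<subset> F (Suc i)) \<and>
        (\<forall>i\<le>card A. free_arrangement K l (F i) \<and> card (F i) = i))"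

text \<open>An arrangement in a subspace \<open>Y\<close> of \<open>K\<^sup>l\<close>, such as a restriction, is regarded as an
  arrangement in \<open>K\<^sup>m\<close> by a choice of linear coordinates on \<open>Y\<close>. Being additionally free does
  not depend on this choice, since a linear change of coordinates induces an automorphism of the
  polynomial ring. As every subspace has coordinates, the quantification over them below is
  never vacuous.\<close>

definition linear_coords ::
    "'a ring \<Rightarrow> nat \<Rightarrow> (nat \<Rightarrow> 'a) set \<Rightarrow> nat \<Rightarrow> ((nat \<Rightarrow> 'a) \<Rightarrow> (nat \<Rightarrow> 'a)) \<Rightarrow> bool" where
  "linear_coords K l Y m \<phi> \<longleftrightarrow>
     (let V = coord_space K l; W = coord_space K m in
        bij_betw \<phi> (carrier W) Y \<and>
        (\<forall>u\<in>carrier W. \<forall>v\<in>carrier W. \<phi> (u \<oplus>\<^bsub>W\<^esub> v) = \<phi> u \<oplus>\<^bsub>V\<^esub> \<phi> v) \<and>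
        (\<forall>c\<in>carrier K. \<forall>v\<in>carrier W. \<phi> (c \<odot>\<^bsub>W\<^esub> v) = c \<odot>\<^bsub>V\<^esub> \<phi> v))"

definition in_coords ::
    "'a ring \<Rightarrow> nat \<Rightarrow> ((nat \<Rightarrow> 'a) \<Rightarrow> (nat \<Rightarrow> 'a)) \<Rightarrow>
       (nat \<Rightarrow> 'a) set set \<Rightarrow> (nat \<Rightarrow> 'a) set set" where
  "in_coords K m \<phi> B = {{v \<in> carrier (coord_space K m). \<phi> v \<in> H} | H. H \<in> B}"

definition additionally_free_on ::
    "'a ring \<Rightarrow> nat \<Rightarrow> (nat \<Rightarrow> 'a) set \<Rightarrow> (nat \<Rightarrow> 'a) set set \<Rightarrow> bool" where
  "additionally_free_on K l Y B \<longleftrightarrow>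
     (\<forall>m \<phi>. linear_coords K l Y m \<phi> \<longrightarrow> additionally_free K m (in_coords K m \<phi> B))"

end

theory Submission
  imports Defs "HOL-Computational_Algebra.Polynomial"
begin

text \<open>Over the complex numbers let \<open>A\<close> be the arrangement of the ten hyperplanes in \<open>K\<^sup>4\<close> defined by
  \<open>w (x\<^sup>2 - w\<^sup>2) (y\<^sup>2 - w\<^sup>2) (z\<^sup>2 - w\<^sup>2) (x + y) (y + z) (z + x)\<close>. It is additionally free, while its restriction
  to the hyperplane \<open>w = 0\<close>, given by \<open>x y z (x + y) (y + z) (z + x)\<close> in \<open>K\<^sup>3\<close>, is not even free.

  Put \<open>F = x\<^sup>2 - w\<^sup>2\<close>, \<open>G = y\<^sup>2 - w\<^sup>2\<close> and \<open>H = z\<^sup>2 - w\<^sup>2\<close>. The Euler field together with \<open>(x + y) (F, G, -H)\<close>,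
  \<open>(y + z) (-F, G, H)\<close> and \<open>(z + x) (F, -G, H)\<close> is a basis of the logarithmic derivations of \<open>A\<close>. It arises
  when the hyperplanes are added one by one in the order of the factors above. In every step all
  basis fields but one are already tangent to the new hyperplane, and it suffices to multiply the
  remaining one by the new form (lemma \<open>field_basis_add\<close>). Before the last three steps the fields along
  the coordinate axes are replaced by the combinations with the signs displayed above; the matrix of
  signs has determinant 4 and is invertible (\<open>field_basis_change\<close>). The chain is assembled in
  \<open>additionally_free_ten\<close>.

  The logarithmic derivations of the restriction are the fields \<open>(x a, y b, z c)\<close> such that \<open>x + y\<close>
  divides \<open>a - b\<close>, \<open>y + z\<close> divides \<open>b - c\<close> and \<open>z + x\<close> divides \<open>a - c\<close>. Up to the Euler field this is the
  module of syzygies of three independent linear forms, which is not free because of the Koszul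
  relation among its three generators; \<open>six_not_free\<close> is an elementary version of this argument.

  To reach these computations, polynomials are identified with polynomial functions, derivations with
  polynomial vector fields, and logarithmic derivations with those fields which at each point of a
  hyperplane of the arrangement are tangent to it (\<open>log_derivation_iff\<close>).\<close>

section \<open>Polynomial functions on complex coordinate space\<close>

text \<open>The complex numbers are infinite, so a polynomial may be replaced by its function of values. The
  rules repeat the way in which the polynomial ring is generated, so that both inductions run in
  parallel.\<close>

inductive_set polyfun :: "nat \<Rightarrow> ((nat \<Rightarrow> complex) \<Rightarrow> complex) set" for l where
  const: "(\<lambda>v. c) \<in> polyfun l"
| add: "\<lbrakk>f \<in> polyfun l; g \<in> polyfun l\<rbrakk> \<Longrightarrow> (\<lambda>v. f v + g v) \<in> polyfun l"
| mult_var: "\<lbrakk>f \<in> polyfun l; i < l\<rbrakk> \<Longrightarrow> (\<lambda>v. f v * v i) \<in> polyfun l"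

lemma polyfun_var: "i < l \<Longrightarrow> (\<lambda>v. v i) \<in> polyfun l"
  using polyfun.mult_var[OF polyfun.const, of i l 1] by simp

lemma polyfun_mult:
  assumes "f \<in> polyfun l" "g \<in> polyfun l" shows "(\<lambda>v. f v * g v) \<in> polyfun l"
  using assms(1)
proof induction
  case (const c)
  show ?case using assms(2)
  proof induction
    case (add f g)
    then show ?case using polyfun.add[OF add.IH] by (simp add: distrib_left)
  next
    case (mult_var f i)
    then show ?case using polyfun.mult_var[OF mult_var.IH] by (simp add: mult.assoc)
  qed (rule polyfun.const)
next
  case (add f h)
  then show ?case using polyfun.add[OF add.IH] by (simp add: distrib_right)
next
  case (mult_var f i)
  have "(\<lambda>v. f v * v i * g v) = (\<lambda>v. f v * g v * v i)" by (auto simp: mult_ac)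
  then show ?case using polyfun.mult_var[OF mult_var.IH mult_var.hyps(2)] by simp
qed

lemma polyfun_uminus: "f \<in> polyfun l \<Longrightarrow> (\<lambda>v. - f v) \<in> polyfun l"
  using polyfun_mult[OF polyfun.const[of "-1"]] by simp

lemma polyfun_diff:
  "f \<in> polyfun l \<Longrightarrow> g \<in> polyfun l \<Longrightarrow> (\<lambda>v. f v - g v) \<in> polyfun l"
  using polyfun.add[OF _ polyfun_uminus, of f l g] by simp

lemma polyfun_sum:
  "(\<And>i. i \<in> I \<Longrightarrow> f i \<in> polyfun l) \<Longrightarrow> (\<lambda>v. \<Sum>i\<in>I. f i v) \<in> polyfun l"
  by (induction I rule: infinite_finite_induct) (auto intro: polyfun.const polyfun.add)

lemma polyfun_prod:
  "(\<And>i. i \<in> I \<Longrightarrow> f i \<in> polyfun l) \<Longrightarrow> (\<lambda>v. \<Prod>i\<in>I. f i v) \<in> polyfun l"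
  by (induction I rule: infinite_finite_induct) (auto intro: polyfun.const polyfun_mult)

lemmas polyfun_intros =
  polyfun.const polyfun.add polyfun_var polyfun_mult polyfun_uminus polyfun_diff
  polyfun_sum polyfun_prod

lemma polyfun_cong:
  assumes "f \<in> polyfun l" "\<And>i. i < l \<Longrightarrow> u i = v i" shows "f u = f v"
  using assms by induction auto

text \<open>Restricted to a line, a polynomial function is a polynomial in the parameter. This reduces
  questions on several variables to one variable.\<close>

lemma polyfun_line:
  assumes "f \<in> polyfun l"
  shows "\<exists>p. \<forall>t. f (\<lambda>i. u i + t * w i) = poly p t"
  using assms
proof induction
  case (const c)
  show ?case by (rule exI[of _ "[:c:]"]) simp
next
  case (add f g)
  then obtain p q where "\<forall>t. f (\<lambda>i. u i + t * w i) = poly p t"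
    "\<forall>t. g (\<lambda>i. u i + t * w i) = poly q t" by blast
  then show ?case by (intro exI[of _ "p + q"]) simp
next
  case (mult_var f i)
  then obtain p where "\<forall>t. f (\<lambda>i. u i + t * w i) = poly p t" by blast
  then show ?case by (intro exI[of _ "p * [:u i, w i:]"]) (simp add: algebra_simps)
qed

text \<open>Two points at which the factors do not vanish are joined by a line, on which both factors
  are nonzero polynomials in one variable.\<close>

lemma polyfun_no_zero_divisors:
  assumes "f \<in> polyfun l" "g \<in> polyfun l"
    and W: "\<And>u w t. \<lbrakk>u \<in> W; w \<in> W\<rbrakk> \<Longrightarrow> (\<lambda>i. u i + t * (w i - u i)) \<in> W"
    and 0: "\<And>v. v \<in> W \<Longrightarrow> f v * g v = 0"
  shows "(\<forall>v\<in>W. f v = 0) \<or> (\<forall>v\<in>W. g v = 0)"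
proof (rule ccontr)
  assume "\<not> ?thesis"
  then obtain u w where uw: "u \<in> W" "f u \<noteq> 0" "w \<in> W" "g w \<noteq> 0" by blast
  obtain p where p: "\<And>t. f (\<lambda>i. u i + t * (w i - u i)) = poly p t"
    using polyfun_line[OF assms(1), of u "\<lambda>i. w i - u i"] by blast
  obtain q where q: "\<And>t. g (\<lambda>i. u i + t * (w i - u i)) = poly q t"
    using polyfun_line[OF assms(2), of u "\<lambda>i. w i - u i"] by blast
  have "poly (p * q) t = 0" for t
    using 0[OF W[OF uw(1,3), of t]] p[of t] q[of t] by simp
  then have "p * q = 0" using poly_all_0_iff_0 by blast
  moreover have "p \<noteq> 0" using p[of 0] uw(2) by auto
  moreover have "q \<noteq> 0" using q[of 1] uw(4) by auto
  ultimately show False by simp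
qed

lemma polyfun_cancel:
  assumes "f \<in> polyfun l" "g \<in> polyfun l" "\<And>v. f v * g v = 0" "f u \<noteq> 0"
  shows "g v = 0"
  using polyfun_no_zero_divisors[of f l g UNIV] assms by auto

section \<open>Linear forms\<close>

definition dot :: "nat \<Rightarrow> (nat \<Rightarrow> complex) \<Rightarrow> (nat \<Rightarrow> complex) \<Rightarrow> complex" where
  "dot l a v = (\<Sum>i<l. a i * v i)"

lemma polyfun_dot: "(\<And>i. i < l \<Longrightarrow> g i \<in> polyfun m) \<Longrightarrow> (\<lambda>v. dot l a (\<lambda>i. g i v)) \<in> polyfun m"
  unfolding dot_def by (intro polyfun_sum polyfun_mult polyfun.const) auto

lemma polyfun_dot_id: "dot l a \<in> polyfun l"
  using polyfun_dot[of l "\<lambda>i v. v i" l a] by (simp add: polyfun_var)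

lemma dot_line: "dot l a (\<lambda>i. u i + t * w i) = dot l a u + t * dot l a w"
  unfolding dot_def by (simp add: distrib_left sum.distrib sum_distrib_left algebra_simps)

lemma dot_diff: "dot l a (\<lambda>i. u i - w i) = dot l a u - dot l a w"
  using dot_line[of l a u "-1" w] by simp

lemma dot_kernel_line:
  "dot l a u = 0 \<Longrightarrow> dot l a w = 0 \<Longrightarrow> dot l a (\<lambda>i. u i + t * (w i - u i)) = 0"
  by (simp add: dot_line dot_diff)

lemma dot_restrict: "dot l a (restrict v {..<l}) = dot l a v"
  unfolding dot_def by (intro sum.cong) auto

text \<open>Projecting along a coordinate axis onto the kernel of the form changes a polynomial function
  by a multiple of the form.\<close>

lemma polyfun_dvd:
  assumes f: "f \<in> polyfun l" and a: "j < l" "a j \<noteq> 0"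
    and 0: "\<And>v. dot l a v = 0 \<Longrightarrow> f v = 0"
  obtains k where "k \<in> polyfun l" "\<And>v. f v = dot l a v * k v"
proof -
  define \<pi> where "\<pi> v = v(j := v j - dot l a v / a j)" for v
  have "\<exists>k\<in>polyfun l. \<forall>v. f v - f (\<pi> v) = dot l a v * k v"
    using f
  proof induction
    case (const c)
    show ?case by (rule bexI[OF _ polyfun.const[of 0]]) simp
  next
    case (add f g)
    obtain k where k: "k \<in> polyfun l" "\<forall>v. f v - f (\<pi> v) = dot l a v * k v"
      using add.IH(1) by (elim bexE)
    obtain k' where k': "k' \<in> polyfun l" "\<forall>v. g v - g (\<pi> v) = dot l a v * k' v"
      using add.IH(2) by (elim bexE)
    have "\<forall>v. (f v + g v) - (f (\<pi> v) + g (\<pi> v)) = dot l a v * (k v + k' v)"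
      unfolding distrib_left k(2)[rule_format, symmetric] k'(2)[rule_format, symmetric] by simp
    then show ?case using polyfun.add[OF k(1) k'(1)] by (intro bexI)
  next
    case (mult_var f i)
    then obtain k where k: "k \<in> polyfun l" "\<And>v. f v - f (\<pi> v) = dot l a v * k v" by blast
    show ?case
    proof (cases "i = j")
      case False
      then have "\<forall>v. f v * v i - f (\<pi> v) * \<pi> v i = dot l a v * (k v * v i)"
        unfolding mult.assoc[symmetric] k(2)[symmetric] by (simp add: \<pi>_def left_diff_distrib)
      then show ?thesis using polyfun.mult_var[OF k(1) mult_var(2)] by (intro bexI)
    next
      case True
      have "f v * v i - f (\<pi> v) * \<pi> v i
          = dot l a v * (k v * v i + (f v - dot l a v * k v) * (1 / a j))" for v
      proof -
        have 1: "f (\<pi> v) = f v - dot l a v * k v" using k(2)[of v] by (simp add: algebra_simps)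
        show ?thesis unfolding 1 using True a(2) by (simp add: \<pi>_def field_simps)
      qed
      moreover have "(\<lambda>v. k v * v i + (f v - dot l a v * k v) * (1 / a j)) \<in> polyfun l"
        using k(1) mult_var by (intro polyfun_intros polyfun_dot_id)
      ultimately show ?thesis by (intro bexI allI)
    qed
  qed
  then obtain k where k: "k \<in> polyfun l" "\<And>v. f v - f (\<pi> v) = dot l a v * k v" by blast
  have "dot l a (\<pi> v) = 0" for v
  proof -
    have "\<pi> v = (\<lambda>i. v i + (- dot l a v / a j) * (if i = j then 1 else 0))"
      by (auto simp: \<pi>_def)
    moreover have "dot l a (\<lambda>i. if i = j then 1 else 0) = a j"
      using a(1) by (simp add: dot_def if_distrib cong: if_cong)
    ultimately show ?thesis using a(2) by (simp only: dot_line) simp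
  qed
  then have "f v = dot l a v * k v" for v using k(2)[of v] 0[of "\<pi> v"] by simp
  then show ?thesis using k(1) that by blast
qed

text \<open>A vector off the smaller hyperplane but on the larger one would, together with the smaller
  hyperplane, span the whole space, and the second form would vanish.\<close>

lemma dot_kernel_mono:
  assumes sub: "\<And>v. dot l a v = 0 \<Longrightarrow> dot l b v = 0" and u: "dot l b u \<noteq> 0"
    and v: "dot l b v = 0"
  shows "dot l a v = 0"
proof (rule ccontr)
  assume nz: "dot l a v \<noteq> 0"
  have "dot l a (\<lambda>i. u i + (- dot l a u / dot l a v) * v i) = 0" unfolding dot_line using nz by simp
  from sub[OF this] show False using u v unfolding dot_line by simp
qed

section \<open>The directional derivative\<close>

text \<open>A derivation of the polynomial ring is differentiation along a vector field; taking the
  derivative along each line in the analytic sense makes the Leibniz rule available.\<close>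

definition has_dir_deriv ::
    "((nat \<Rightarrow> complex) \<Rightarrow> complex) \<Rightarrow> complex \<Rightarrow> (nat \<Rightarrow> complex) \<Rightarrow> (nat \<Rightarrow> complex) \<Rightarrow> bool" where
  "has_dir_deriv f d v w \<longleftrightarrow> ((\<lambda>t. f (\<lambda>i. v i + t * w i)) has_field_derivative d) (at 0)"

lemma has_dir_deriv_unique: "has_dir_deriv f d v w \<Longrightarrow> has_dir_deriv f e v w \<Longrightarrow> d = e"
  unfolding has_dir_deriv_def by (rule DERIV_unique)

lemma has_dir_deriv_const: "has_dir_deriv (\<lambda>_. c) 0 v w"
  unfolding has_dir_deriv_def by simp

lemma has_dir_deriv_var: "has_dir_deriv (\<lambda>v. v i) (w i) v w"
  unfolding has_dir_deriv_def by (auto intro!: derivative_eq_intros)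

lemma has_dir_deriv_add:
  "has_dir_deriv f d v w \<Longrightarrow> has_dir_deriv g e v w \<Longrightarrow> has_dir_deriv (\<lambda>v. f v + g v) (d + e) v w"
  unfolding has_dir_deriv_def by (rule DERIV_add)

lemma has_dir_deriv_mult:
  assumes "has_dir_deriv f d v w" "has_dir_deriv g e v w"
  shows "has_dir_deriv (\<lambda>v. f v * g v) (f v * e + d * g v) v w"
  using DERIV_mult[OF assms[unfolded has_dir_deriv_def]]
  unfolding has_dir_deriv_def by (simp add: algebra_simps)

lemma has_dir_deriv_sum:
  "(\<And>i. i \<in> I \<Longrightarrow> has_dir_deriv (f i) (d i) v w) \<Longrightarrow>
    has_dir_deriv (\<lambda>v. \<Sum>i\<in>I. f i v) (\<Sum>i\<in>I. d i) v w"
  by (induction I rule: infinite_finite_induct)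
     (auto intro: has_dir_deriv_const has_dir_deriv_add)

lemma has_dir_deriv_dot: "has_dir_deriv (dot l a) (dot l a w) v w"
  unfolding dot_def
  using has_dir_deriv_sum[where I="{..<l}", OF has_dir_deriv_mult[OF has_dir_deriv_const has_dir_deriv_var]]
  by simp

lemma polyfun_dir_deriv:
  assumes "f \<in> polyfun l" and g: "\<And>i. i < l \<Longrightarrow> g i \<in> polyfun l"
  shows "\<exists>d\<in>polyfun l. \<forall>v. has_dir_deriv f (d v) v (\<lambda>i. g i v)"
  using assms(1)
proof induction
  case (const c)
  show ?case by (intro bexI[OF _ polyfun.const[of 0]] allI has_dir_deriv_const)
next
  case (add f h)
  then obtain d e where "d \<in> polyfun l" "e \<in> polyfun l"
    "\<forall>v. has_dir_deriv f (d v) v (\<lambda>i. g i v)" "\<forall>v. has_dir_deriv h (e v) v (\<lambda>i. g i v)" by blast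
  then show ?case by (intro bexI[OF _ polyfun.add[of d l e]] allI has_dir_deriv_add) auto
next
  case (mult_var f i)
  then obtain d where d: "d \<in> polyfun l" "\<forall>v. has_dir_deriv f (d v) v (\<lambda>i. g i v)" by blast
  have "\<forall>v. has_dir_deriv (\<lambda>v. f v * v i) (f v * g i v + d v * v i) v (\<lambda>i. g i v)"
    by (intro allI has_dir_deriv_mult[OF d(2)[rule_format] has_dir_deriv_var])
  moreover have "(\<lambda>v. f v * g i v + d v * v i) \<in> polyfun l"
    using d(1) mult_var g by (intro polyfun_intros)
  ultimately show ?case by (intro bexI)
qed

section \<open>The polynomial ring as a ring of functions\<close>

definition Cplx :: "complex ring" where
  "Cplx = \<lparr>carrier = UNIV, monoid.mult = (*), monoid.one = 1, ring.zero = 0, ring.add = (+)\<rparr>"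

lemma Cplx_simps [simp]:
  "carrier Cplx = UNIV" "x \<otimes>\<^bsub>Cplx\<^esub> y = x * y" "\<one>\<^bsub>Cplx\<^esub> = 1" "\<zero>\<^bsub>Cplx\<^esub> = 0" "x \<oplus>\<^bsub>Cplx\<^esub> y = x + y"
  by (simp_all add: Cplx_def)

lemma cring_Cplx: "cring Cplx"
proof (rule cringI)
  show "abelian_group Cplx"
  proof (rule abelian_groupI)
    show "\<exists>y\<in>carrier Cplx. y \<oplus>\<^bsub>Cplx\<^esub> x = \<zero>\<^bsub>Cplx\<^esub>" for x :: complex
      by (rule bexI[of _ "- x"]) auto
  qed (auto simp: algebra_simps)
  show "comm_monoid Cplx" by unfold_locales (auto simp: Units_def algebra_simps)
qed (auto simp: algebra_simps)

lemma ring_Cplx: "ring Cplx"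
  using cring_Cplx by (rule cring.axioms)

lemma field_Cplx: "field Cplx"
proof (rule cring.cring_fieldI[OF cring_Cplx])
  show "Units Cplx = carrier Cplx - {\<zero>\<^bsub>Cplx\<^esub>}"
  proof -
    have "\<exists>y. y * x = 1 \<and> x * y = 1" if "x \<noteq> 0" for x :: complex
      using that by (intro exI[of _ "inverse x"]) simp
    then show ?thesis by (auto simp: Units_def)
  qed
qed

lemma finsum_Cplx: "finite A \<Longrightarrow> finsum Cplx f A = sum f A"
proof (induction A rule: finite_induct)
  case empty
  interpret ring Cplx by (rule ring_Cplx)
  show ?case by simp
next
  case (insert a A)
  interpret ring Cplx by (rule ring_Cplx)
  show ?case using insert by (subst finsum_insert) auto
qed

abbreviation S :: "nat \<Rightarrow> (nat multiset \<Rightarrow> complex) ring" where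
  "S \<equiv> sym_algebra Cplx"

abbreviation cst :: "complex \<Rightarrow> nat multiset \<Rightarrow> complex" where
  "cst \<equiv> ring.indexed_const Cplx"

abbreviation var :: "nat \<Rightarrow> nat multiset \<Rightarrow> complex" where
  "var \<equiv> ring.indexed_var Cplx"

lemmas Cplx_poly_defs =
  ring.indexed_const_def[OF ring_Cplx] ring.indexed_padd_def[OF ring_Cplx]
  ring.indexed_pmult_def[OF ring_Cplx] ring.indexed_var_def[OF ring_Cplx]

lemma finite_submultisets: "finite {n. n \<subseteq># m}"
proof (induction m)
  case (add x m)
  have "n \<in> {n. n \<subseteq># m} \<union> add_mset x ` {n. n \<subseteq># m}" if "n \<subseteq># add_mset x m" for n
  proof (cases "x \<in># n")
    case True
    then obtain k where "n = add_mset x k" by (metis multi_member_split)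
    then show ?thesis using that by simp
  next
    case False
    then have "n \<subseteq># m" using that by (metis diff_single_trivial subset_eq_diff_conv add_mset_add_single)
    then show ?thesis by simp
  qed
  then have "{n. n \<subseteq># add_mset x m} \<subseteq> {n. n \<subseteq># m} \<union> add_mset x ` {n. n \<subseteq># m}"
    by (intro subsetI) (simp only: mem_Collect_eq)
  then show ?case by (rule finite_subset) (simp add: add.IH)
qed simp

lemma S_simps:
  "carrier (S l) = ring.indexed_pset Cplx {..<l} UNIV"
  "p \<otimes>\<^bsub>S l\<^esub> q = (\<lambda>m. \<Sum>n | n \<subseteq># m. p n * q (m - n))"
  "\<one>\<^bsub>S l\<^esub> = cst 1" "\<zero>\<^bsub>S l\<^esub> = cst 0" "p \<oplus>\<^bsub>S l\<^esub> q = (\<lambda>m. p m + q m)"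
  by (simp_all add: sym_algebra_def finsum_Cplx finite_submultisets Cplx_poly_defs)

definition mono_fun :: "nat multiset \<Rightarrow> (nat \<Rightarrow> complex) \<Rightarrow> complex" where
  "mono_fun m v = (\<Prod>i\<in>#m. v i)"

lemma mono_fun_simps [simp]: "mono_fun {#} v = 1" "mono_fun (m + n) v = mono_fun m v * mono_fun n v"
  "mono_fun (add_mset i m) v = v i * mono_fun m v"
  by (simp_all add: mono_fun_def)

definition ev :: "(nat multiset \<Rightarrow> complex) \<Rightarrow> (nat \<Rightarrow> complex) \<Rightarrow> complex" where
  "ev p v = (\<Sum>m | p m \<noteq> 0. p m * mono_fun m v)"

lemma ev_superset:
  assumes "finite T" "{m. p m \<noteq> 0} \<subseteq> T" shows "ev p v = (\<Sum>m\<in>T. p m * mono_fun m v)"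
  unfolding ev_def using assms by (intro sum.mono_neutral_left) auto

text \<open>The monomials are pairwise distinct characters of the multiplicative monoid of vectors, so
  they are linearly independent by Dedekind's argument.\<close>

lemma monomials_independent:
  assumes "finite T" "\<And>v. (\<Sum>m\<in>T. c m * mono_fun m v) = 0" "m \<in> T"
  shows "c m = 0"
  using assms
proof (induction T arbitrary: c m rule: finite_induct)
  case (insert n T)
  have T0: "c m = 0" if "m \<in> T" for m
  proof -
    have "m \<noteq> n" using that insert.hyps by auto
    then obtain i where i: "count m i \<noteq> count n i" by (auto simp: multiset_eq_iff)
    define u :: "nat \<Rightarrow> complex" where "u j = (if j = i then 2 else 1)" for j
    have u: "mono_fun k u = 2 ^ count k i" for k
      by (induction k) (auto simp: u_def)
    have "(\<Sum>k\<in>T. (c k * (mono_fun k u - mono_fun n u)) * mono_fun k v) = 0" for v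
    proof -
      have mu: "mono_fun k (\<lambda>j. u j * v j) = mono_fun k u * mono_fun k v" for k
        by (induction k) auto
      have "(\<Sum>k\<in>insert n T. c k * mono_fun k (\<lambda>j. u j * v j))
          - mono_fun n u * (\<Sum>k\<in>insert n T. c k * mono_fun k v) = 0"
        using insert.prems(1) by simp
      also have "(\<Sum>k\<in>insert n T. c k * mono_fun k (\<lambda>j. u j * v j))
          - mono_fun n u * (\<Sum>k\<in>insert n T. c k * mono_fun k v)
          = (\<Sum>k\<in>T. (c k * (mono_fun k u - mono_fun n u)) * mono_fun k v)"
        using insert.hyps
        by (simp add: mu algebra_simps sum_subtractf sum_distrib_left)
      finally show ?thesis .
    qed
    from insert.IH[OF this that] have "c m * (mono_fun m u - mono_fun n u) = 0" .
    moreover have "mono_fun m u \<noteq> mono_fun n u"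
    proof
      assume "mono_fun m u = mono_fun n u"
      then have "(2::complex) ^ count m i = 2 ^ count n i" by (simp add: u)
      then have "norm ((2::complex) ^ count m i) = norm ((2::complex) ^ count n i)" by simp
      then show False using i by (simp add: norm_power)
    qed
    ultimately show ?thesis by simp
  qed
  moreover have "c n = 0"
    using insert.prems(1)[of "\<lambda>_. 1"] insert.hyps T0 by (simp add: mono_fun_def)
  ultimately show ?case using insert.prems by auto
qed simp

lemma ev_inj:
  assumes "finite {m. p m \<noteq> 0}" "finite {m. q m \<noteq> 0}" "\<And>v. ev p v = ev q v"
  shows "p = q"
proof
  fix m
  let ?T = "insert m ({m. p m \<noteq> 0} \<union> {m. q m \<noteq> 0})"
  have T: "finite ?T" using assms by auto
  have "p m - q m = 0"
  proof (rule monomials_independent[OF T])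
    fix v
    have "ev p v = (\<Sum>m\<in>?T. p m * mono_fun m v)" "ev q v = (\<Sum>m\<in>?T. q m * mono_fun m v)"
      using T by (intro ev_superset; auto)+
    then show "(\<Sum>m\<in>?T. (p m - q m) * mono_fun m v) = 0"
      using assms(3)[of v] by (simp add: left_diff_distrib sum_subtractf)
  qed auto
  then show "p m = q m" by simp
qed

lemma ev_const [simp]: "ev (cst c) v = c"
  by (subst ev_superset[of "{{#}}"]) (auto simp: Cplx_poly_defs)

lemma ev_add:
  assumes "finite {m. p m \<noteq> 0}" "finite {m. q m \<noteq> 0}"
  shows "finite {m. p m + q m \<noteq> 0}" "ev (\<lambda>m. p m + q m) v = ev p v + ev q v"
proof -
  let ?T = "{m. p m \<noteq> 0} \<union> {m. q m \<noteq> 0}"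
  have T: "finite ?T" using assms by simp
  show "finite {m. p m + q m \<noteq> 0}" by (rule finite_subset[OF _ T]) auto
  have "ev p v = (\<Sum>m\<in>?T. p m * mono_fun m v)" "ev q v = (\<Sum>m\<in>?T. q m * mono_fun m v)"
    "ev (\<lambda>m. p m + q m) v = (\<Sum>m\<in>?T. (p m + q m) * mono_fun m v)"
    using T by (intro ev_superset; auto)+
  then show "ev (\<lambda>m. p m + q m) v = ev p v + ev q v" by (simp add: distrib_right sum.distrib)
qed

lemma ev_mult:
  assumes "finite {m. p m \<noteq> 0}" "finite {m. q m \<noteq> 0}"
  shows "finite {m. (p \<otimes>\<^bsub>S l\<^esub> q) m \<noteq> 0}" "ev (p \<otimes>\<^bsub>S l\<^esub> q) v = ev p v * ev q v"
proof -
  let ?P = "{m. p m \<noteq> 0}" and ?Q = "{m. q m \<noteq> 0}"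
  let ?T = "(\<lambda>(n, k). n + k) ` (?P \<times> ?Q)"
  have T: "finite ?T" using assms by simp
  have fib: "(p \<otimes>\<^bsub>S l\<^esub> q) m = (\<Sum>(n, k) | (n, k) \<in> ?P \<times> ?Q \<and> n + k = m. p n * q k)" for m
  proof -
    let ?N = "{n. n \<subseteq># m \<and> p n \<noteq> 0 \<and> q (m - n) \<noteq> 0}"
    have "{(n, k). (n, k) \<in> ?P \<times> ?Q \<and> n + k = m} = (\<lambda>n. (n, m - n)) ` ?N" by auto
    then have "(\<Sum>(n, k) | (n, k) \<in> ?P \<times> ?Q \<and> n + k = m. p n * q k) = (\<Sum>n\<in>?N. p n * q (m - n))"
      by (simp add: sum.reindex inj_on_def)
    also have "\<dots> = (\<Sum>n | n \<subseteq># m. p n * q (m - n))"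
      using finite_submultisets by (intro sum.mono_neutral_left) auto
    finally show ?thesis by (simp add: S_simps)
  qed
  have sub: "{m. (p \<otimes>\<^bsub>S l\<^esub> q) m \<noteq> 0} \<subseteq> ?T"
  proof
    fix m assume "m \<in> {m. (p \<otimes>\<^bsub>S l\<^esub> q) m \<noteq> 0}"
    then have "{(n, k). (n, k) \<in> ?P \<times> ?Q \<and> n + k = m} \<noteq> {}"
      unfolding fib by (auto elim!: sum.not_neutral_contains_not_neutral)
    then show "m \<in> ?T" by auto
  qed
  show "finite {m. (p \<otimes>\<^bsub>S l\<^esub> q) m \<noteq> 0}" by (rule finite_subset[OF sub T])
  have "ev (p \<otimes>\<^bsub>S l\<^esub> q) v = (\<Sum>m\<in>?T. (p \<otimes>\<^bsub>S l\<^esub> q) m * mono_fun m v)"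
    by (rule ev_superset[OF T sub])
  also have "\<dots> = (\<Sum>m\<in>?T. \<Sum>x\<in>{x \<in> ?P \<times> ?Q. (case x of (n, k) \<Rightarrow> n + k) = m}.
      (case x of (n, k) \<Rightarrow> (p n * mono_fun n v) * (q k * mono_fun k v)))"
    unfolding fib sum_distrib_right by (intro sum.cong) (auto simp: mult_ac)
  also have "\<dots> = (\<Sum>(n, k)\<in>?P \<times> ?Q. (p n * mono_fun n v) * (q k * mono_fun k v))"
    using assms by (intro sum.group) auto
  also have "\<dots> = ev p v * ev q v"
    unfolding ev_def by (simp add: sum_product sum.cartesian_product)
  finally show "ev (p \<otimes>\<^bsub>S l\<^esub> q) v = ev p v * ev q v" .
qed

lemma pmult_var: "ring.indexed_pmult Cplx p i = p \<otimes>\<^bsub>S l\<^esub> var i"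
proof
  fix m
  have v: "var i k = (if k = {#i#} then 1 else 0)" for k
    by (auto simp: Cplx_poly_defs dest: multi_member_split)
  have "n = m - {#i#} \<and> i \<in># m" if "n \<subseteq># m" "m - n = {#i#}" for n
    using that by (auto simp: subset_mset.le_iff_add)
  then have 1: "{n. n \<subseteq># m} \<inter> {n. m - n = {#i#}} = (if i \<in># m then {m - {#i#}} else {})"
    by (auto dest: multi_member_split)
  have "(p \<otimes>\<^bsub>S l\<^esub> var i) m = (\<Sum>n | n \<subseteq># m. if m - n = {#i#} then p n else 0)"
    unfolding S_simps v by (intro sum.cong) auto
  also have "\<dots> = (\<Sum>n\<in>{n. n \<subseteq># m} \<inter> {n. m - n = {#i#}}. p n)"
    by (subst sum.inter_restrict) (auto simp: finite_submultisets)
  also have "\<dots> = ring.indexed_pmult Cplx p i m"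
    unfolding 1 by (simp add: Cplx_poly_defs)
  finally show "ring.indexed_pmult Cplx p i m = (p \<otimes>\<^bsub>S l\<^esub> var i) m" ..
qed

lemma finite_const: "finite {m. cst c m \<noteq> 0}"
  by (rule finite_subset[of _ "{{#}}"]) (auto simp: Cplx_poly_defs)

lemma finite_var: "finite {m. var i m \<noteq> 0}"
  by (rule finite_subset[of _ "{{#i#}}"]) (auto simp: Cplx_poly_defs dest: multi_member_split)

lemma ev_var [simp]: "ev (var i) v = v i"
  by (subst ev_superset[of "{{#i#}}"]) (auto simp: Cplx_poly_defs dest: multi_member_split)

lemma S_carrier_intros:
  "cst c \<in> carrier (S l)"
  "\<lbrakk>p \<in> carrier (S l); q \<in> carrier (S l)\<rbrakk> \<Longrightarrow> ring.indexed_padd Cplx p q \<in> carrier (S l)"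
  "\<lbrakk>p \<in> carrier (S l); i < l\<rbrakk> \<Longrightarrow> ring.indexed_pmult Cplx p i \<in> carrier (S l)"
  unfolding S_simps(1) by (auto intro: ring.indexed_pset.intros[OF ring_Cplx])

lemma S_induct [consumes 1, case_names const add mult_var]:
  assumes "p \<in> carrier (S l)" "\<And>c. P (cst c)"
    "\<And>p q. \<lbrakk>p \<in> carrier (S l); P p; q \<in> carrier (S l); P q\<rbrakk> \<Longrightarrow> P (p \<oplus>\<^bsub>S l\<^esub> q)"
    "\<And>p i. \<lbrakk>p \<in> carrier (S l); P p; i < l\<rbrakk> \<Longrightarrow> P (p \<otimes>\<^bsub>S l\<^esub> var i)"
  shows "P p"
  using assms(1)[unfolded S_simps(1)]
proof (induction rule: ring.indexed_pset.induct[OF ring_Cplx, consumes 1])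
  case (2 p q)
  then show ?case using assms(3)[of p q] by (simp add: S_simps Cplx_poly_defs)
next
  case (3 p i)
  then show ?case using assms(4)[of p i] by (simp add: S_simps(1) pmult_var[of _ _ l])
qed (rule assms(2))

lemma S_finite: "p \<in> carrier (S l) \<Longrightarrow> finite {m. p m \<noteq> 0}"
proof (induction rule: S_induct)
  case (add p q)
  then show ?case using ev_add(1) by (simp add: S_simps)
qed (auto intro: finite_const finite_var ev_mult(1))

lemma ev_eqI: "\<lbrakk>p \<in> carrier (S l); q \<in> carrier (S l); \<And>v. ev p v = ev q v\<rbrakk> \<Longrightarrow> p = q"
  by (rule ev_inj[OF S_finite S_finite])

lemma ev_ops:
  assumes "p \<in> carrier (S l)" "q \<in> carrier (S l)"
  shows ev_S_add: "ev (p \<oplus>\<^bsub>S l\<^esub> q) v = ev p v + ev q v"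
    and ev_S_mult: "ev (p \<otimes>\<^bsub>S l\<^esub> q) v = ev p v * ev q v"
  using ev_add(2) ev_mult(2) S_finite[OF assms(1)] S_finite[OF assms(2)] by (auto simp: S_simps(5))

lemma const_carrier [simp]: "cst c \<in> carrier (S l)"
  by (rule S_carrier_intros)

lemma S_add_carrier [simp]:
  "p \<in> carrier (S l) \<Longrightarrow> q \<in> carrier (S l) \<Longrightarrow> p \<oplus>\<^bsub>S l\<^esub> q \<in> carrier (S l)"
  using S_carrier_intros(2)[of p l q] by (simp add: S_simps(5) Cplx_poly_defs)

lemma S_mult_var_carrier: "p \<in> carrier (S l) \<Longrightarrow> i < l \<Longrightarrow> p \<otimes>\<^bsub>S l\<^esub> var i \<in> carrier (S l)"
  using S_carrier_intros(3)[of p l i] by (simp add: pmult_var[of _ _ l])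

lemma var_carrier [simp]: "i < l \<Longrightarrow> var i \<in> carrier (S l)"
  unfolding ring.indexed_var_def[OF ring_Cplx] by (rule S_carrier_intros) auto

lemma ev_polyfun: "p \<in> carrier (S l) \<Longrightarrow> ev p \<in> polyfun l"
proof (induction rule: S_induct)
  case (const c)
  have "ev (cst c) = (\<lambda>v. c)" by auto
  then show ?case by (simp add: polyfun.const)
next
  case (add p q)
  then have "ev (p \<oplus>\<^bsub>S l\<^esub> q) = (\<lambda>v. ev p v + ev q v)" by (auto simp: ev_ops)
  then show ?case using add by (simp add: polyfun.add)
next
  case (mult_var p i)
  then have "ev (p \<otimes>\<^bsub>S l\<^esub> var i) = (\<lambda>v. ev p v * v i)" by (auto simp: ev_ops)
  then show ?case using mult_var by (simp add: polyfun.mult_var)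
qed

lemma polyfun_ev: "f \<in> polyfun l \<Longrightarrow> \<exists>p\<in>carrier (S l). ev p = f"
proof (induction rule: polyfun.induct)
  case (const c)
  show ?case by (rule bexI[of _ "cst c"]) auto
next
  case (add f g)
  then obtain p q where "p \<in> carrier (S l)" "ev p = f" "q \<in> carrier (S l)" "ev q = g" by blast
  then show ?case by (intro bexI[of _ "p \<oplus>\<^bsub>S l\<^esub> q"]) (auto simp: ev_ops)
next
  case (mult_var f i)
  then obtain p where "p \<in> carrier (S l)" "ev p = f" by blast
  then show ?case using mult_var(2)
    by (intro bexI[of _ "p \<otimes>\<^bsub>S l\<^esub> var i"]) (auto simp: ev_ops S_mult_var_carrier)
qed

definition poly_of :: "nat \<Rightarrow> ((nat \<Rightarrow> complex) \<Rightarrow> complex) \<Rightarrow> nat multiset \<Rightarrow> complex" where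
  "poly_of l f = (SOME p. p \<in> carrier (S l) \<and> ev p = f)"

lemma poly_of:
  assumes "f \<in> polyfun l"
  shows poly_of_carrier: "poly_of l f \<in> carrier (S l)" and ev_poly_of: "ev (poly_of l f) = f"
  using someI_ex[of "\<lambda>p. p \<in> carrier (S l) \<and> ev p = f"] polyfun_ev[OF assms]
  unfolding poly_of_def by blast+

text \<open>The ring is generated by multiplication by variables only, so closure under the convolution
  product has to be derived: the product of two polynomial functions is the function of some element
  of the ring, and the convolution, being finitely supported, has to be that element.\<close>

lemma S_mult_carrier [simp]:
  assumes "p \<in> carrier (S l)" "q \<in> carrier (S l)" shows "p \<otimes>\<^bsub>S l\<^esub> q \<in> carrier (S l)"
proof -
  have f: "(\<lambda>v. ev p v * ev q v) \<in> polyfun l" using assms by (intro polyfun_mult ev_polyfun)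
  have "p \<otimes>\<^bsub>S l\<^esub> q = poly_of l (\<lambda>v. ev p v * ev q v)"
    by (rule ev_inj[OF ev_mult(1)])
       (auto simp: S_finite[OF assms(1)] S_finite[OF assms(2)] S_finite[OF poly_of_carrier[OF f]]
          ev_poly_of[OF f] ev_ops[OF assms])
  then show ?thesis using poly_of_carrier[OF f] by simp
qed

lemma S_zero_one [simp]: "\<zero>\<^bsub>S l\<^esub> \<in> carrier (S l)" "\<one>\<^bsub>S l\<^esub> \<in> carrier (S l)"
  "ev \<zero>\<^bsub>S l\<^esub> v = 0" "ev \<one>\<^bsub>S l\<^esub> v = 1"
  by (simp_all add: S_simps(3,4))

lemma cring_S: "cring (S l)"
proof (rule cringI)
  show "abelian_group (S l)"
  proof (rule abelian_groupI)
    fix p assume p: "p \<in> carrier (S l)"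
    show "\<exists>q\<in>carrier (S l). q \<oplus>\<^bsub>S l\<^esub> p = \<zero>\<^bsub>S l\<^esub>"
      using p by (intro bexI[of _ "cst (-1) \<otimes>\<^bsub>S l\<^esub> p"] ev_eqI[of _ l]) (auto simp: ev_ops)
  qed (auto intro!: ev_eqI[of _ l] simp: ev_ops)
  show "comm_monoid (S l)"
    by (rule comm_monoidI) (auto intro!: ev_eqI[of _ l] simp: ev_ops)
qed (auto intro!: ev_eqI[of _ l] simp: ev_ops distrib_right)

lemma ev_finsum:
  assumes "\<And>i. i \<in> I \<Longrightarrow> f i \<in> carrier (S l)" "finite I"
  shows "ev (finsum (S l) f I) v = (\<Sum>i\<in>I. ev (f i) v)"
proof -
  interpret cring "S l" by (rule cring_S)
  show ?thesis using assms(2,1)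
    by (induction I rule: finite_induct) (auto simp: ev_ops finsum_insert Pi_iff)
qed

lemma ev_finprod:
  assumes "\<And>i. i \<in> I \<Longrightarrow> f i \<in> carrier (S l)" "finite I"
  shows "finprod (S l) f I \<in> carrier (S l)" "ev (finprod (S l) f I) v = (\<Prod>i\<in>I. ev (f i) v)"
proof -
  interpret cring "S l" by (rule cring_S)
  show "ev (finprod (S l) f I) v = (\<Prod>i\<in>I. ev (f i) v)" using assms(2,1)
    by (induction I rule: finite_induct) (auto simp: ev_ops finprod_insert Pi_iff)
  show "finprod (S l) f I \<in> carrier (S l)" using assms by (intro finprod_closed) auto
qed

lemma linear_poly:
  "linear_poly Cplx l a \<in> carrier (S l)" "ev (linear_poly Cplx l a) v = dot l a v"
proof -
  interpret cring "S l" by (rule cring_S)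
  show "linear_poly Cplx l a \<in> carrier (S l)"
    unfolding linear_poly_def by (intro finsum_closed) auto
  show "ev (linear_poly Cplx l a) v = dot l a v"
    unfolding linear_poly_def dot_def by (subst ev_finsum) (auto simp: ev_ops)
qed

lemma defining_poly:
  assumes "finite A"
  shows "defining_poly Cplx l A \<in> carrier (S l)"
    "ev (defining_poly Cplx l A) v = (\<Prod>H\<in>A. dot l (chosen_form Cplx l H) v)"
  unfolding defining_poly_def using assms by (auto simp: ev_finprod linear_poly)

section \<open>Derivations are polynomial vector fields\<close>

lemma derivation_dest:
  assumes "\<theta> \<in> derivations Cplx l"
  shows derivation_carrier: "p \<in> carrier (S l) \<Longrightarrow> \<theta> p \<in> carrier (S l)"
    and derivation_undef: "p \<notin> carrier (S l) \<Longrightarrow> \<theta> p = undefined"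
    and derivation_add: "\<lbrakk>p \<in> carrier (S l); q \<in> carrier (S l)\<rbrakk> \<Longrightarrow>
      \<theta> (p \<oplus>\<^bsub>S l\<^esub> q) = \<theta> p \<oplus>\<^bsub>S l\<^esub> \<theta> q"
    and derivation_scale: "p \<in> carrier (S l) \<Longrightarrow> \<theta> (cst c \<otimes>\<^bsub>S l\<^esub> p) = cst c \<otimes>\<^bsub>S l\<^esub> \<theta> p"
    and derivation_mult: "\<lbrakk>p \<in> carrier (S l); q \<in> carrier (S l)\<rbrakk> \<Longrightarrow>
      \<theta> (p \<otimes>\<^bsub>S l\<^esub> q) = (p \<otimes>\<^bsub>S l\<^esub> \<theta> q) \<oplus>\<^bsub>S l\<^esub> (\<theta> p \<otimes>\<^bsub>S l\<^esub> q)"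
  using assms unfolding derivations_def Let_def by (auto simp: PiE_def Pi_def extensional_def)

text \<open>Both sides obey the same rules on the generators of the ring, so a derivation is determined by
  its values on the variables, the components of a vector field.\<close>

lemma derivation_dir_deriv:
  assumes \<theta>: "\<theta> \<in> derivations Cplx l" and "p \<in> carrier (S l)"
  shows "has_dir_deriv (ev p) (ev (\<theta> p) v) v (\<lambda>i. ev (\<theta> (var i)) v)"
  using assms(2)
proof (induction rule: S_induct)
  case (const c)
  have "\<theta> (cst 1 \<otimes>\<^bsub>S l\<^esub> cst 1) = (cst 1 \<otimes>\<^bsub>S l\<^esub> \<theta> (cst 1)) \<oplus>\<^bsub>S l\<^esub> (\<theta> (cst 1) \<otimes>\<^bsub>S l\<^esub> cst 1)"
    by (rule derivation_mult[OF \<theta>]) auto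
  then have "ev (\<theta> (cst 1 \<otimes>\<^bsub>S l\<^esub> cst 1)) v = ev (\<theta> (cst 1)) v + ev (\<theta> (cst 1)) v"
    using derivation_carrier[OF \<theta>, of "cst 1"] by (simp add: ev_ops)
  moreover have "cst 1 \<otimes>\<^bsub>S l\<^esub> cst 1 = cst 1"
    by (rule ev_eqI[of _ l]) (auto simp: ev_ops)
  ultimately have "ev (\<theta> (cst 1)) v = ev (\<theta> (cst 1)) v + ev (\<theta> (cst 1)) v" by simp
  then have 1: "ev (\<theta> (cst 1)) v = 0" by simp
  have "cst c = cst c \<otimes>\<^bsub>S l\<^esub> cst 1"
    by (rule ev_eqI[of _ l]) (auto simp: ev_ops)
  then have "\<theta> (cst c) = cst c \<otimes>\<^bsub>S l\<^esub> \<theta> (cst 1)"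
    using derivation_scale[OF \<theta>, of "cst 1" c] by simp
  then have "ev (\<theta> (cst c)) v = 0"
    using derivation_carrier[OF \<theta>, of "cst 1"] 1 by (simp add: ev_ops)
  moreover have "ev (cst c) = (\<lambda>_. c)" by auto
  ultimately show ?case using has_dir_deriv_const by simp
next
  case (add p q)
  have "ev (p \<oplus>\<^bsub>S l\<^esub> q) = (\<lambda>v. ev p v + ev q v)" using add by (auto simp: ev_ops)
  moreover have "ev (\<theta> (p \<oplus>\<^bsub>S l\<^esub> q)) v = ev (\<theta> p) v + ev (\<theta> q) v"
    using add by (simp add: derivation_add[OF \<theta>] ev_ops derivation_carrier[OF \<theta>])
  ultimately show ?case using has_dir_deriv_add[OF add.IH] by simp
next
  case (mult_var p i)
  have "ev (p \<otimes>\<^bsub>S l\<^esub> var i) = (\<lambda>v. ev p v * v i)" using mult_var by (auto simp: ev_ops)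
  moreover have "ev (\<theta> (p \<otimes>\<^bsub>S l\<^esub> var i)) v = ev p v * ev (\<theta> (var i)) v + ev (\<theta> p) v * v i"
    using mult_var by (simp add: derivation_mult[OF \<theta>] ev_ops derivation_carrier[OF \<theta>])
  ultimately show ?case using has_dir_deriv_mult[OF mult_var.IH has_dir_deriv_var] by simp
qed

lemma has_dir_deriv_cong:
  assumes "f \<in> polyfun l" "\<And>i. i < l \<Longrightarrow> w i = w' i" "has_dir_deriv f d v w"
  shows "has_dir_deriv f d v w'"
proof -
  have "f (\<lambda>i. v i + t * w i) = f (\<lambda>i. v i + t * w' i)" for t
    by (rule polyfun_cong[OF assms(1)]) (simp add: assms(2))
  then show ?thesis using assms(3) unfolding has_dir_deriv_def by simp
qed

lemma derivation_eqI:
  assumes "\<theta> \<in> derivations Cplx l" "\<eta> \<in> derivations Cplx l"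
    and "\<And>i v. i < l \<Longrightarrow> ev (\<theta> (var i)) v = ev (\<eta> (var i)) v"
  shows "\<theta> = \<eta>"
proof
  fix p
  show "\<theta> p = \<eta> p"
  proof (cases "p \<in> carrier (S l)")
    case True
    have "ev (\<theta> p) v = ev (\<eta> p) v" for v
      by (rule has_dir_deriv_unique[OF derivation_dir_deriv[OF assms(1) True]
            has_dir_deriv_cong[OF ev_polyfun[OF True] _ derivation_dir_deriv[OF assms(2) True]]])
         (simp add: assms(3))
    then show ?thesis
      by (rule ev_eqI[OF derivation_carrier[OF assms(1) True] derivation_carrier[OF assms(2) True]])
  qed (simp add: derivation_undef[OF assms(1)] derivation_undef[OF assms(2)])
qed

text \<open>A derivation with prescribed components; directional derivatives are unique, so the choice is
  forced.\<close>

definition der_of :: "nat \<Rightarrow> (nat \<Rightarrow> (nat \<Rightarrow> complex) \<Rightarrow> complex) \<Rightarrow>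
    (nat multiset \<Rightarrow> complex) \<Rightarrow> (nat multiset \<Rightarrow> complex)" where
  "der_of l g = (\<lambda>p\<in>carrier (S l).
     SOME q. q \<in> carrier (S l) \<and> (\<forall>v. has_dir_deriv (ev p) (ev q v) v (\<lambda>i. g i v)))"

lemma der_of:
  assumes g: "\<And>i. i < l \<Longrightarrow> g i \<in> polyfun l"
  shows der_of_derivation: "der_of l g \<in> derivations Cplx l"
    and ev_der_of: "i < l \<Longrightarrow> ev (der_of l g (var i)) = g i"
proof -
  have *: "der_of l g p \<in> carrier (S l)"
    "has_dir_deriv (ev p) (ev (der_of l g p) v) v (\<lambda>i. g i v)" if p: "p \<in> carrier (S l)" for p v
  proof -
    obtain d where d: "d \<in> polyfun l" "\<forall>v. has_dir_deriv (ev p) (d v) v (\<lambda>i. g i v)"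
      using polyfun_dir_deriv[where g=g, OF ev_polyfun[OF p] g] by blast
    have "\<exists>q. q \<in> carrier (S l) \<and> (\<forall>v. has_dir_deriv (ev p) (ev q v) v (\<lambda>i. g i v))"
      by (rule exI[of _ "poly_of l d"]) (simp add: d poly_of_carrier ev_poly_of)
    from someI_ex[OF this] show "der_of l g p \<in> carrier (S l)"
      "has_dir_deriv (ev p) (ev (der_of l g p) v) v (\<lambda>i. g i v)"
      using p by (simp_all add: der_of_def)
  qed
  have eq: "der_of l g p = q"
    if "p \<in> carrier (S l)" "q \<in> carrier (S l)" "\<And>v. has_dir_deriv (ev p) (ev q v) v (\<lambda>i. g i v)" for p q
    using *[OF that(1)] that by (auto intro!: ev_eqI[of _ l] has_dir_deriv_unique)
  have evs: "ev (p \<oplus>\<^bsub>S l\<^esub> q) = (\<lambda>v. ev p v + ev q v)" "ev (p \<otimes>\<^bsub>S l\<^esub> q) = (\<lambda>v. ev p v * ev q v)"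
    if "p \<in> carrier (S l)" "q \<in> carrier (S l)" for p q
    using that by (auto simp: ev_ops)
  have cst: "ev (cst c) = (\<lambda>_. c)" for c by auto
  have add: "der_of l g (p \<oplus>\<^bsub>S l\<^esub> q) = der_of l g p \<oplus>\<^bsub>S l\<^esub> der_of l g q"
    if "p \<in> carrier (S l)" "q \<in> carrier (S l)" for p q
    using that by (intro eq) (auto simp: * evs intro!: has_dir_deriv_add)
  have mult: "der_of l g (p \<otimes>\<^bsub>S l\<^esub> q)
      = (p \<otimes>\<^bsub>S l\<^esub> der_of l g q) \<oplus>\<^bsub>S l\<^esub> (der_of l g p \<otimes>\<^bsub>S l\<^esub> q)"
    if "p \<in> carrier (S l)" "q \<in> carrier (S l)" for p q
    using that by (intro eq) (auto simp: * evs intro!: has_dir_deriv_mult)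
  have scale: "der_of l g (cst c \<otimes>\<^bsub>S l\<^esub> p) = cst c \<otimes>\<^bsub>S l\<^esub> der_of l g p"
    if "p \<in> carrier (S l)" for c p
  proof (rule eq)
    have "has_dir_deriv (\<lambda>v. c * ev p v) (c * ev (der_of l g p) v + 0 * ev p v) v (\<lambda>i. g i v)" for v
      by (rule has_dir_deriv_mult[OF has_dir_deriv_const *(2)[OF that]])
    then show "has_dir_deriv (ev (cst c \<otimes>\<^bsub>S l\<^esub> p)) (ev (cst c \<otimes>\<^bsub>S l\<^esub> der_of l g p) v) v (\<lambda>i. g i v)" for v
      using that * by (simp add: evs)
  qed (use that * in auto)
  show "der_of l g \<in> derivations Cplx l"
    unfolding derivations_def Let_def
    using * add mult scale by (auto simp: der_of_def)
  assume i: "i < l"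
  have "ev (var i) = (\<lambda>v. v i)" by auto
  then have "has_dir_deriv (ev (var i)) (g i v) v (\<lambda>i. g i v)" for v
    using has_dir_deriv_var[of i "\<lambda>i. g i v" v] by simp
  then show "ev (der_of l g (var i)) = g i"
    using *(2)[OF var_carrier[OF i]] has_dir_deriv_unique by blast
qed

section \<open>Logarithmic derivations are the tangent vector fields\<close>

lemma coord_carrier: "v \<in> carrier (coord_space Cplx l) \<longleftrightarrow> restrict v {..<l} = v"
  unfolding coord_space_def by (auto simp: PiE_def extensional_restrict) (metis restrict_extensional)

lemma kernel_mem: "v \<in> form_kernel Cplx l a \<longleftrightarrow> restrict v {..<l} = v \<and> dot l a v = 0"
  unfolding form_kernel_def by (simp add: coord_carrier finsum_Cplx dot_def)

lemma kernel_iff: "restrict v {..<l} \<in> form_kernel Cplx l a \<longleftrightarrow> dot l a v = 0"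
  by (simp add: kernel_mem dot_restrict)

lemma kernel_eqI: "(\<And>v. dot l a v = 0 \<longleftrightarrow> dot l b v = 0) \<Longrightarrow> form_kernel Cplx l a = form_kernel Cplx l b"
  by (simp add: set_eq_iff kernel_mem)

lemma defines_hyperplane_iff:
  "defines_hyperplane Cplx l a H \<longleftrightarrow>
     restrict a {..<l} = a \<and> (\<exists>j<l. a j \<noteq> 0) \<and> H = form_kernel Cplx l a"
proof -
  have "a \<noteq> \<zero>\<^bsub>coord_space Cplx l\<^esub> \<longleftrightarrow> (\<exists>j<l. a j \<noteq> 0)" if "restrict a {..<l} = a"
  proof -
    have "a = \<zero>\<^bsub>coord_space Cplx l\<^esub>" if 0: "\<forall>i<l. a i = 0"
    proof -
      have "restrict a {..<l} = restrict (\<lambda>i. 0) {..<l}" using 0 by (intro restrict_ext) auto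
      then show ?thesis using \<open>restrict a {..<l} = a\<close> by (simp add: coord_space_def)
    qed
    moreover have "\<forall>i<l. a i = 0" if "a = \<zero>\<^bsub>coord_space Cplx l\<^esub>"
      using that by (simp add: coord_space_def)
    ultimately show ?thesis by blast
  qed
  then show ?thesis unfolding defines_hyperplane_def coord_carrier by blast
qed

definition tangent :: "nat \<Rightarrow> (nat \<Rightarrow> complex) set set \<Rightarrow> (nat \<Rightarrow> (nat \<Rightarrow> complex) \<Rightarrow> complex) \<Rightarrow> bool" where
  "tangent l A g \<longleftrightarrow>
     (\<forall>H\<in>A. \<forall>v. restrict v {..<l} \<in> H \<longrightarrow> restrict (\<lambda>i. g i v) {..<l} \<in> H)"

lemma arrangement_form:
  assumes "arrangement Cplx l A" "H \<in> A"
  shows "\<exists>j<l. chosen_form Cplx l H j \<noteq> 0" "form_kernel Cplx l (chosen_form Cplx l H) = H"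
proof -
  have "defines_hyperplane Cplx l (chosen_form Cplx l H) H"
    using assms unfolding arrangement_def chosen_form_def by (metis someI_ex)
  then show "\<exists>j<l. chosen_form Cplx l H j \<noteq> 0" "form_kernel Cplx l (chosen_form Cplx l H) = H"
    unfolding defines_hyperplane_iff by auto
qed

lemma dot_nonzero: "j < l \<Longrightarrow> a j \<noteq> 0 \<Longrightarrow> \<exists>u. dot l a u \<noteq> 0"
  by (rule exI[of _ "\<lambda>i. if i = j then 1 else 0"]) (simp add: dot_def if_distrib cong: if_cong)

lemma polyfun_prod_nonvanishing:
  assumes "finite I" "\<And>i. i \<in> I \<Longrightarrow> f i \<in> polyfun l" "\<And>i. i \<in> I \<Longrightarrow> \<exists>v. dot l a v = 0 \<and> f i v \<noteq> 0"
  shows "\<exists>v. dot l a v = 0 \<and> (\<Prod>i\<in>I. f i v) \<noteq> 0"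
  using assms
proof (induction I rule: finite_induct)
  case empty
  show ?case by (rule exI[of _ "\<lambda>_. 0"]) (simp add: dot_def)
next
  case (insert i I)
  have "(\<forall>v\<in>{v. dot l a v = 0}. f i v = 0) \<or> (\<forall>v\<in>{v. dot l a v = 0}. (\<Prod>i\<in>I. f i v) = 0)"
    if "\<And>v. dot l a v = 0 \<Longrightarrow> f i v * (\<Prod>i\<in>I. f i v) = 0"
    using insert.prems that
    by (intro polyfun_no_zero_divisors[of _ l] polyfun_prod) (auto simp: dot_kernel_line)
  moreover have "\<exists>v. dot l a v = 0 \<and> f i v \<noteq> 0" "\<exists>v. dot l a v = 0 \<and> (\<Prod>i\<in>I. f i v) \<noteq> 0"
    using insert by auto
  ultimately show ?case using insert.hyps by auto
qed

text \<open>On a hyperplane \<open>H\<close> all summands of the Leibniz expansion of \<open>\<theta>(Q)\<close> vanish, except the one in which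
  the form of \<open>H\<close> is differentiated; its cofactor does not vanish identically on \<open>H\<close>, because the other
  hyperplanes are different from \<open>H\<close>. So divisibility of \<open>\<theta>(Q)\<close> by \<open>Q\<close> says that the field is tangent to
  every \<open>H\<close>, a condition which does not mention the chosen forms.\<close>

lemma log_derivation_iff:
  assumes A: "arrangement Cplx l A" and \<theta>: "\<theta> \<in> derivations Cplx l"
  shows "\<theta> (defining_poly Cplx l A) \<in> PIdl\<^bsub>S l\<^esub> (defining_poly Cplx l A) \<longleftrightarrow>
    tangent l A (\<lambda>i. ev (\<theta> (var i)))"
proof -
  let ?Q = "defining_poly Cplx l A" and ?\<alpha> = "\<lambda>H. dot l (chosen_form Cplx l H)"
  let ?g = "\<lambda>v i. ev (\<theta> (var i)) v"
  have fin: "finite A" using A by (simp add: arrangement_def)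
  note Q = defining_poly[OF fin, of l]
  note \<alpha> = arrangement_form[OF A]
  have tan: "tangent l A (\<lambda>i. ev (\<theta> (var i))) \<longleftrightarrow> (\<forall>H\<in>A. \<forall>v. ?\<alpha> H v = 0 \<longrightarrow> ?\<alpha> H (?g v) = 0)"
    unfolding tangent_def
  proof (intro ball_cong refl)
    fix H assume "H \<in> A"
    then have "restrict v {..<l} \<in> H \<longleftrightarrow> ?\<alpha> H v = 0" for v
      using kernel_iff[of v l "chosen_form Cplx l H"] \<alpha>(2) by simp
    then show "(\<forall>v. restrict v {..<l} \<in> H \<longrightarrow> restrict (\<lambda>i. ev (\<theta> (var i)) v) {..<l} \<in> H)
        \<longleftrightarrow> (\<forall>v. ?\<alpha> H v = 0 \<longrightarrow> ?\<alpha> H (?g v) = 0)" by simp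
  qed
  have gp: "(\<lambda>v. ?\<alpha> H (?g v)) \<in> polyfun l" for H
    using derivation_carrier[OF \<theta>] by (intro polyfun_dot ev_polyfun) auto
  have lz: "has_dir_deriv (\<lambda>v. \<Prod>H\<in>B. ?\<alpha> H v) (\<Sum>H\<in>B. ?\<alpha> H w * (\<Prod>H'\<in>B - {H}. ?\<alpha> H' v)) v w"
    if "finite B" for B v w
    using that
  proof (induction B rule: finite_induct)
    case (insert H B)
    have "(\<Sum>H'\<in>B. ?\<alpha> H' w * (\<Prod>H''\<in>insert H B - {H'}. ?\<alpha> H'' v))
        = (\<Sum>H'\<in>B. ?\<alpha> H v * (?\<alpha> H' w * (\<Prod>H''\<in>B - {H'}. ?\<alpha> H'' v)))"
    proof (rule sum.cong[OF refl])
      fix H' assume "H' \<in> B"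
      then have "insert H B - {H'} = insert H (B - {H'})" using insert.hyps by auto
      then show "?\<alpha> H' w * (\<Prod>H''\<in>insert H B - {H'}. ?\<alpha> H'' v)
          = ?\<alpha> H v * (?\<alpha> H' w * (\<Prod>H''\<in>B - {H'}. ?\<alpha> H'' v))"
        using insert.hyps by (simp add: mult_ac)
    qed
    moreover have "insert H B - {H} = B" using insert.hyps by auto
    ultimately have eq: "(\<Sum>H'\<in>insert H B. ?\<alpha> H' w * (\<Prod>H''\<in>insert H B - {H'}. ?\<alpha> H'' v))
        = ?\<alpha> H v * (\<Sum>H'\<in>B. ?\<alpha> H' w * (\<Prod>H''\<in>B - {H'}. ?\<alpha> H'' v)) + ?\<alpha> H w * (\<Prod>H'\<in>B. ?\<alpha> H' v)"
      using insert.hyps by (simp add: sum_distrib_left add.commute)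
    have "(\<lambda>v. \<Prod>H\<in>insert H B. ?\<alpha> H v) = (\<lambda>v. ?\<alpha> H v * (\<Prod>H\<in>B. ?\<alpha> H v))"
      using insert.hyps by simp
    then show ?case
      unfolding eq by (simp only: has_dir_deriv_mult[OF has_dir_deriv_dot insert.IH])
  qed (simp add: has_dir_deriv_const)
  have evQ: "ev ?Q = (\<lambda>v. \<Prod>H\<in>A. ?\<alpha> H v)" using Q(2) by auto
  have \<theta>Q: "ev (\<theta> ?Q) v = (\<Sum>H\<in>A. ?\<alpha> H (?g v) * (\<Prod>H'\<in>A - {H}. ?\<alpha> H' v))" for v
    using has_dir_deriv_unique[OF derivation_dir_deriv[OF \<theta> Q(1)]] lz[OF fin] unfolding evQ by blast
  have split: "(\<Prod>H\<in>A. ?\<alpha> H v) = ?\<alpha> H v * (\<Prod>H'\<in>A - {H}. ?\<alpha> H' v)" if "H \<in> A" for H v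
    using fin that by (rule prod.remove)
  have "ev (\<theta> ?Q) \<in> polyfun l" using Q(1) derivation_carrier[OF \<theta>] ev_polyfun by blast
  show ?thesis
  proof
    assume "\<theta> ?Q \<in> PIdl\<^bsub>S l\<^esub> ?Q"
    then obtain h where h: "h \<in> carrier (S l)" "\<theta> ?Q = h \<otimes>\<^bsub>S l\<^esub> ?Q"
      unfolding cgenideal_def by auto
    have "?\<alpha> H (?g v) = 0" if H: "H \<in> A" and v: "?\<alpha> H v = 0" for H v
    proof -
      let ?R = "\<lambda>v. \<Prod>H'\<in>A - {H}. ?\<alpha> H' v" and ?W = "{v. ?\<alpha> H v = 0}"
      have "?\<alpha> H (?g u) * ?R u = 0" if u: "?\<alpha> H u = 0" for u
      proof -
        have "(\<Sum>H'\<in>A. ?\<alpha> H' (?g u) * (\<Prod>H''\<in>A - {H'}. ?\<alpha> H'' u)) = ?\<alpha> H (?g u) * ?R u"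
        proof (subst sum.remove[OF fin H])
          have "(\<Prod>H''\<in>A - {H'}. ?\<alpha> H'' u) = 0" if "H' \<in> A - {H}" for H'
            using that u H fin by (intro prod_zero) auto
          then show "?\<alpha> H (?g u) * ?R u
              + (\<Sum>H'\<in>A - {H}. ?\<alpha> H' (?g u) * (\<Prod>H''\<in>A - {H'}. ?\<alpha> H'' u)) = ?\<alpha> H (?g u) * ?R u"
            by simp
        qed
        then have "ev (\<theta> ?Q) u = ?\<alpha> H (?g u) * ?R u" using \<theta>Q by simp
        moreover have "ev (\<theta> ?Q) u = 0"
          using h Q(1) u split[OF H, of u] by (simp add: ev_ops evQ)
        ultimately show ?thesis by simp
      qed
      then have "(\<forall>v\<in>?W. ?\<alpha> H (?g v) = 0) \<or> (\<forall>v\<in>?W. ?R v = 0)"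
        by (intro polyfun_no_zero_divisors[OF gp] polyfun_prod polyfun_dot_id)
           (auto simp: dot_kernel_line)
      moreover have "\<exists>v. ?\<alpha> H v = 0 \<and> ?R v \<noteq> 0"
      proof (rule polyfun_prod_nonvanishing)
        fix H' assume H': "H' \<in> A - {H}"
        show "\<exists>v. ?\<alpha> H v = 0 \<and> ?\<alpha> H' v \<noteq> 0"
        proof (rule ccontr)
          assume "\<not> ?thesis"
          then have sub: "\<And>v. ?\<alpha> H v = 0 \<Longrightarrow> ?\<alpha> H' v = 0" by blast
          obtain u where "?\<alpha> H' u \<noteq> 0" using \<alpha>(1)[of H'] dot_nonzero H' by blast
          from dot_kernel_mono[OF sub this]
          have "form_kernel Cplx l (chosen_form Cplx l H) = form_kernel Cplx l (chosen_form Cplx l H')"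
            using sub by (intro kernel_eqI) blast
          then show False using \<alpha>(2) H H' by auto
        qed
      qed (use fin in \<open>auto intro: polyfun_dot_id\<close>)
      ultimately show ?thesis using v by auto
    qed
    then show "tangent l A (\<lambda>i. ev (\<theta> (var i)))" unfolding tan by blast
  next
    assume "tangent l A (\<lambda>i. ev (\<theta> (var i)))"
    then have "\<exists>k. k \<in> polyfun l \<and> (\<forall>v. ?\<alpha> H (?g v) = ?\<alpha> H v * k v)" if "H \<in> A" for H
      using \<alpha>(1)[OF that] that polyfun_dvd[OF gp, of _ "chosen_form Cplx l H" H]
      unfolding tan by metis
    then obtain k where k: "\<And>H. H \<in> A \<Longrightarrow> k H \<in> polyfun l"
      "\<And>H v. H \<in> A \<Longrightarrow> ?\<alpha> H (?g v) = ?\<alpha> H v * k H v" by metis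
    let ?k = "\<lambda>v. \<Sum>H\<in>A. k H v"
    have kp: "?k \<in> polyfun l" using k(1) by (rule polyfun_sum)
    have "\<theta> ?Q = poly_of l ?k \<otimes>\<^bsub>S l\<^esub> ?Q"
    proof (rule ev_eqI)
      fix v
      have "ev (\<theta> ?Q) v = (\<Sum>H\<in>A. k H v * (\<Prod>H\<in>A. ?\<alpha> H v))"
        unfolding \<theta>Q using k(2) split by (intro sum.cong) (auto simp: mult_ac)
      then show "ev (\<theta> ?Q) v = ev (poly_of l ?k \<otimes>\<^bsub>S l\<^esub> ?Q) v"
        using Q(1) kp by (simp add: ev_ops poly_of_carrier ev_poly_of evQ sum_distrib_right)
    qed (use Q(1) kp derivation_carrier[OF \<theta>] poly_of_carrier in auto)
    then show "\<theta> ?Q \<in> PIdl\<^bsub>S l\<^esub> ?Q"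
      unfolding cgenideal_def using poly_of_carrier[OF kp] by auto
  qed
qed

section \<open>Freeness in terms of vector fields\<close>

abbreviation LD :: "nat \<Rightarrow> (nat \<Rightarrow> complex) set set \<Rightarrow> _" where
  "LD l A \<equiv> log_derivations Cplx l A"

abbreviation comps :: "((nat multiset \<Rightarrow> complex) \<Rightarrow> (nat multiset \<Rightarrow> complex)) \<Rightarrow>
    nat \<Rightarrow> (nat \<Rightarrow> complex) \<Rightarrow> complex" where
  "comps \<theta> \<equiv> (\<lambda>i. ev (\<theta> (var i)))"

definition log_fields :: "nat \<Rightarrow> (nat \<Rightarrow> complex) set set \<Rightarrow> (nat \<Rightarrow> (nat \<Rightarrow> complex) \<Rightarrow> complex) set" where
  "log_fields l A = {g. (\<forall>i<l. g i \<in> polyfun l) \<and> tangent l A g}"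

lemma tangent_iff:
  assumes "arrangement Cplx l A"
  shows "tangent l A g \<longleftrightarrow>
    (\<forall>a. form_kernel Cplx l a \<in> A \<longrightarrow> (\<forall>v. dot l a v = 0 \<longrightarrow> dot l a (\<lambda>i. g i v) = 0))"
proof (intro iffI allI impI)
  fix a v assume "tangent l A g" "form_kernel Cplx l a \<in> A" "dot l a v = 0"
  then show "dot l a (\<lambda>i. g i v) = 0"
    unfolding tangent_def kernel_iff[symmetric] by (elim ballE[of _ _ "form_kernel Cplx l a"]) auto
next
  assume *: "\<forall>a. form_kernel Cplx l a \<in> A \<longrightarrow> (\<forall>v. dot l a v = 0 \<longrightarrow> dot l a (\<lambda>i. g i v) = 0)"
  show "tangent l A g"
    unfolding tangent_def
  proof (intro ballI allI impI)
    fix H v assume H: "H \<in> A" and v: "restrict v {..<l} \<in> H"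
    have eq: "form_kernel Cplx l (chosen_form Cplx l H) = H" by (rule arrangement_form(2)[OF assms H])
    show "restrict (\<lambda>i. g i v) {..<l} \<in> H"
      using *[rule_format, of "chosen_form Cplx l H" v] H v unfolding kernel_iff[symmetric] eq by blast
  qed
qed

lemma tangent_cong:
  assumes "\<And>i v. i < l \<Longrightarrow> g i v = h i v" "tangent l A g" shows "tangent l A h"
proof -
  have "restrict (\<lambda>i. g i v) {..<l} = restrict (\<lambda>i. h i v) {..<l}" for v
    using assms(1) by (intro restrict_ext) auto
  then show ?thesis using assms(2) unfolding tangent_def by simp
qed

lemma tangent_add:
  assumes "arrangement Cplx l A" "tangent l A g" "tangent l A h"
  shows "tangent l A (\<lambda>i v. g i v + h i v)"
  using assms(2,3) unfolding tangent_iff[OF assms(1)]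
  by (auto simp: dot_def distrib_left sum.distrib)

lemma tangent_scale:
  assumes "arrangement Cplx l A" "tangent l A g"
  shows "tangent l A (\<lambda>i v. f v * g i v)"
proof -
  have "dot l a (\<lambda>i. f v * g i v) = f v * dot l a (\<lambda>i. g i v)" for a v
    by (simp add: dot_def sum_distrib_left mult_ac)
  then show ?thesis using assms(2) unfolding tangent_iff[OF assms(1)] by simp
qed

lemma tangent_zero: "arrangement Cplx l A \<Longrightarrow> tangent l A (\<lambda>i v. 0)"
  by (simp add: tangent_iff dot_def)

lemma LD_ops:
  "\<zero>\<^bsub>LD l A\<^esub> = (\<lambda>f\<in>carrier (S l). \<zero>\<^bsub>S l\<^esub>)"
  "\<theta> \<oplus>\<^bsub>LD l A\<^esub> \<eta> = (\<lambda>f\<in>carrier (S l). \<theta> f \<oplus>\<^bsub>S l\<^esub> \<eta> f)"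
  "p \<odot>\<^bsub>LD l A\<^esub> \<theta> = (\<lambda>f\<in>carrier (S l). p \<otimes>\<^bsub>S l\<^esub> \<theta> f)"
  by (simp_all add: log_derivations_def Der_def Let_def)

lemma LD_carrier:
  assumes "arrangement Cplx l A"
  shows "\<theta> \<in> carrier (LD l A) \<longleftrightarrow> \<theta> \<in> derivations Cplx l \<and> tangent l A (comps \<theta>)"
  using log_derivation_iff[OF assms] by (auto simp: log_derivations_def)

lemma derivationI:
  assumes "\<theta> \<in> extensional (carrier (S l))"
    "\<And>p. p \<in> carrier (S l) \<Longrightarrow> \<theta> p \<in> carrier (S l)"
    "\<And>p q v. \<lbrakk>p \<in> carrier (S l); q \<in> carrier (S l)\<rbrakk> \<Longrightarrow>
      ev (\<theta> (p \<oplus>\<^bsub>S l\<^esub> q)) v = ev (\<theta> p) v + ev (\<theta> q) v"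
    "\<And>c p v. p \<in> carrier (S l) \<Longrightarrow> ev (\<theta> (cst c \<otimes>\<^bsub>S l\<^esub> p)) v = c * ev (\<theta> p) v"
    "\<And>p q v. \<lbrakk>p \<in> carrier (S l); q \<in> carrier (S l)\<rbrakk> \<Longrightarrow>
      ev (\<theta> (p \<otimes>\<^bsub>S l\<^esub> q)) v = ev p v * ev (\<theta> q) v + ev (\<theta> p) v * ev q v"
  shows "\<theta> \<in> derivations Cplx l"
  unfolding derivations_def Let_def
proof (intro CollectI conjI ballI)
  show "\<theta> \<in> carrier (S l) \<rightarrow>\<^sub>E carrier (S l)" using assms(1,2) by (simp add: PiE_def)
  fix p assume p: "p \<in> carrier (S l)"
  show "\<theta> (cst c \<otimes>\<^bsub>S l\<^esub> p) = cst c \<otimes>\<^bsub>S l\<^esub> \<theta> p" for c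
    by (rule ev_eqI[of _ l]) (simp_all add: p assms(2,4) ev_ops)
  fix q assume q: "q \<in> carrier (S l)"
  show "\<theta> (p \<oplus>\<^bsub>S l\<^esub> q) = \<theta> p \<oplus>\<^bsub>S l\<^esub> \<theta> q"
    by (rule ev_eqI[of _ l]) (simp_all add: p q assms(2,3) ev_ops)
  show "\<theta> (p \<otimes>\<^bsub>S l\<^esub> q) = (p \<otimes>\<^bsub>S l\<^esub> \<theta> q) \<oplus>\<^bsub>S l\<^esub> (\<theta> p \<otimes>\<^bsub>S l\<^esub> q)"
    by (rule ev_eqI[of _ l]) (simp_all add: p q assms(2,5) ev_ops)
qed

lemma derivation_const:
  assumes "\<theta> \<in> derivations Cplx l" shows "ev (\<theta> (cst c)) v = 0"
proof -
  have "ev (cst c) = (\<lambda>_. c)" by auto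
  then have "has_dir_deriv (\<lambda>_. c) (ev (\<theta> (cst c)) v) v (\<lambda>i. ev (\<theta> (var i)) v)"
    using derivation_dir_deriv[OF assms const_carrier, of c v] by simp
  then show ?thesis using has_dir_deriv_const by (rule has_dir_deriv_unique)
qed

lemma LD_closed:
  assumes A: "arrangement Cplx l A"
  shows LD_zero: "\<zero>\<^bsub>LD l A\<^esub> \<in> carrier (LD l A)"
    and LD_add: "\<lbrakk>\<theta> \<in> carrier (LD l A); \<eta> \<in> carrier (LD l A)\<rbrakk> \<Longrightarrow> \<theta> \<oplus>\<^bsub>LD l A\<^esub> \<eta> \<in> carrier (LD l A)"
    and LD_smult: "\<lbrakk>p \<in> carrier (S l); \<theta> \<in> carrier (LD l A)\<rbrakk> \<Longrightarrow> p \<odot>\<^bsub>LD l A\<^esub> \<theta> \<in> carrier (LD l A)"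
proof -
  note c = LD_carrier[OF A]
  have "\<zero>\<^bsub>LD l A\<^esub> \<in> derivations Cplx l"
    by (rule derivationI) (auto simp: LD_ops)
  moreover have "tangent l A (comps \<zero>\<^bsub>LD l A\<^esub>)"
    by (rule tangent_cong[OF _ tangent_zero[OF A]]) (simp add: LD_ops)
  ultimately show "\<zero>\<^bsub>LD l A\<^esub> \<in> carrier (LD l A)" unfolding c by blast
next
  note c = LD_carrier[OF A]
  assume \<theta>: "\<theta> \<in> carrier (LD l A)" and \<eta>: "\<eta> \<in> carrier (LD l A)"
  note d = derivation_carrier derivation_add derivation_const derivation_mult
  note d\<theta> = d[OF \<theta>[unfolded c, THEN conjunct1]] and d\<eta> = d[OF \<eta>[unfolded c, THEN conjunct1]]
  have "\<theta> \<oplus>\<^bsub>LD l A\<^esub> \<eta> \<in> derivations Cplx l"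
    by (rule derivationI) (auto simp: LD_ops d\<theta> d\<eta> ev_ops algebra_simps)
  moreover have "tangent l A (comps (\<theta> \<oplus>\<^bsub>LD l A\<^esub> \<eta>))"
    by (rule tangent_cong[OF _ tangent_add[OF A, of "comps \<theta>" "comps \<eta>"]])
       (use \<theta> \<eta> in \<open>auto simp: LD_ops d\<theta> d\<eta> ev_ops c\<close>)
  ultimately show "\<theta> \<oplus>\<^bsub>LD l A\<^esub> \<eta> \<in> carrier (LD l A)" unfolding c by blast
next
  note c = LD_carrier[OF A]
  assume p: "p \<in> carrier (S l)" and \<theta>: "\<theta> \<in> carrier (LD l A)"
  note d = derivation_carrier derivation_add derivation_const derivation_mult
  note d\<theta> = d[OF \<theta>[unfolded c, THEN conjunct1]]
  have "p \<odot>\<^bsub>LD l A\<^esub> \<theta> \<in> derivations Cplx l"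
    by (rule derivationI) (auto simp: LD_ops d\<theta> p ev_ops algebra_simps)
  moreover have "tangent l A (comps (p \<odot>\<^bsub>LD l A\<^esub> \<theta>))"
    by (rule tangent_cong[OF _ tangent_scale[OF A, of "comps \<theta>" "ev p"]])
       (use \<theta> p in \<open>auto simp: LD_ops d\<theta> ev_ops c\<close>)
  ultimately show "p \<odot>\<^bsub>LD l A\<^esub> \<theta> \<in> carrier (LD l A)" unfolding c by blast
qed

lemma LD_eqI:
  assumes "arrangement Cplx l A" "\<theta> \<in> carrier (LD l A)" "\<eta> \<in> carrier (LD l A)"
    and "\<And>i v. i < l \<Longrightarrow> comps \<theta> i v = comps \<eta> i v"
  shows "\<theta> = \<eta>"
  using assms LD_carrier[OF assms(1)] by (intro derivation_eqI[of _ l]) auto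

lemma LD_comps:
  assumes "arrangement Cplx l A" "\<theta> \<in> carrier (LD l A)" "i < l"
  shows LD_comp_carrier: "\<theta> (var i) \<in> carrier (S l)"
    and comps_zero: "comps \<zero>\<^bsub>LD l A\<^esub> i v = 0"
    and comps_add: "\<eta> \<in> carrier (LD l A) \<Longrightarrow> comps (\<theta> \<oplus>\<^bsub>LD l A\<^esub> \<eta>) i v = comps \<theta> i v + comps \<eta> i v"
    and comps_smult: "p \<in> carrier (S l) \<Longrightarrow> comps (p \<odot>\<^bsub>LD l A\<^esub> \<theta>) i v = ev p v * comps \<theta> i v"
proof -
  have *: "\<eta> (var i) \<in> carrier (S l)" if "\<eta> \<in> carrier (LD l A)" for \<eta>
    using that assms derivation_carrier unfolding LD_carrier[OF assms(1)] by auto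
  from *[OF assms(2)] show "\<theta> (var i) \<in> carrier (S l)" .
  show "comps \<zero>\<^bsub>LD l A\<^esub> i v = 0" using assms(3) by (simp add: LD_ops)
  show "comps (\<theta> \<oplus>\<^bsub>LD l A\<^esub> \<eta>) i v = comps \<theta> i v + comps \<eta> i v" if "\<eta> \<in> carrier (LD l A)"
    using assms(3) *[OF that] *[OF assms(2)] by (simp add: LD_ops ev_ops)
  show "comps (p \<odot>\<^bsub>LD l A\<^esub> \<theta>) i v = ev p v * comps \<theta> i v" if "p \<in> carrier (S l)"
    using assms(3) *[OF assms(2)] that by (simp add: LD_ops ev_ops)
qed

lemma abelian_monoid_LD:
  assumes A: "arrangement Cplx l A" shows "abelian_monoid (LD l A)"
proof (rule abelian_monoidI)
  note cl = LD_zero[OF A] LD_add[OF A]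
  fix x y z assume x: "x \<in> carrier (LD l A)" and y: "y \<in> carrier (LD l A)"
  show "x \<oplus>\<^bsub>LD l A\<^esub> y \<in> carrier (LD l A)" using cl x y by blast
  show "x \<oplus>\<^bsub>LD l A\<^esub> y = y \<oplus>\<^bsub>LD l A\<^esub> x"
    using cl x y by (intro LD_eqI[OF A]) (auto simp: comps_add[OF A])
  show "\<zero>\<^bsub>LD l A\<^esub> \<oplus>\<^bsub>LD l A\<^esub> x = x"
    using cl x by (intro LD_eqI[OF A]) (auto simp: comps_add[OF A] comps_zero[OF A x])
  assume z: "z \<in> carrier (LD l A)"
  show "x \<oplus>\<^bsub>LD l A\<^esub> y \<oplus>\<^bsub>LD l A\<^esub> z = x \<oplus>\<^bsub>LD l A\<^esub> (y \<oplus>\<^bsub>LD l A\<^esub> z)"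
    using cl x y z by (intro LD_eqI[OF A]) (auto simp: comps_add[OF A])
qed (rule LD_zero[OF A])

lemma LD_combination:
  assumes A: "arrangement Cplx l A" and T: "finite T" "T \<subseteq> carrier (LD l A)"
    and c: "\<And>\<beta>. \<beta> \<in> T \<Longrightarrow> c \<beta> \<in> carrier (S l)"
  shows "(\<Oplus>\<^bsub>LD l A\<^esub>\<beta>\<in>T. c \<beta> \<odot>\<^bsub>LD l A\<^esub> \<beta>) \<in> carrier (LD l A)"
    and "i < l \<Longrightarrow> comps (\<Oplus>\<^bsub>LD l A\<^esub>\<beta>\<in>T. c \<beta> \<odot>\<^bsub>LD l A\<^esub> \<beta>) i v = (\<Sum>\<beta>\<in>T. ev (c \<beta>) v * comps \<beta> i v)"
proof -
  interpret abelian_monoid "LD l A" by (rule abelian_monoid_LD[OF A])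
  have cl: "c \<beta> \<odot>\<^bsub>LD l A\<^esub> \<beta> \<in> carrier (LD l A)" if "\<beta> \<in> T" for \<beta>
    using that T c by (intro LD_smult[OF A]) auto
  then show "(\<Oplus>\<^bsub>LD l A\<^esub>\<beta>\<in>T. c \<beta> \<odot>\<^bsub>LD l A\<^esub> \<beta>) \<in> carrier (LD l A)" by (intro finsum_closed) auto
  assume i: "i < l"
  show "comps (\<Oplus>\<^bsub>LD l A\<^esub>\<beta>\<in>T. c \<beta> \<odot>\<^bsub>LD l A\<^esub> \<beta>) i v = (\<Sum>\<beta>\<in>T. ev (c \<beta>) v * comps \<beta> i v)"
    using T c cl
  proof (induction T rule: finite_induct)
    case empty
    then show ?case using comps_zero[OF A LD_zero[OF A] i] by simp
  next
    case (insert \<beta> T)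
    have "(\<Oplus>\<^bsub>LD l A\<^esub>\<beta>\<in>T. c \<beta> \<odot>\<^bsub>LD l A\<^esub> \<beta>) \<in> carrier (LD l A)"
      using insert.prems by (intro finsum_closed) auto
    then show ?case
      using insert i by (simp add: finsum_insert comps_add[OF A] comps_smult[OF A])
  qed
qed

text \<open>Linear independence and spanning over the polynomial functions, with the components of the
  fields at indices beyond the dimension ignored.\<close>

definition field_basis ::
    "nat \<Rightarrow> (nat \<Rightarrow> complex) set set \<Rightarrow> 'j set \<Rightarrow> ('j \<Rightarrow> nat \<Rightarrow> (nat \<Rightarrow> complex) \<Rightarrow> complex) \<Rightarrow> bool" where
  "field_basis l A J b \<longleftrightarrow>
     (\<forall>j\<in>J. b j \<in> log_fields l A) \<and>
     (\<forall>g\<in>log_fields l A. \<exists>F c. finite F \<and> F \<subseteq> J \<and> (\<forall>j\<in>F. c j \<in> polyfun l) \<and>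
        (\<forall>i<l. \<forall>v. g i v = (\<Sum>j\<in>F. c j v * b j i v))) \<and>
     (\<forall>F c. finite F \<and> F \<subseteq> J \<and> (\<forall>j\<in>F. c j \<in> polyfun l) \<and>
        (\<forall>i<l. \<forall>v. (\<Sum>j\<in>F. c j v * b j i v) = 0) \<longrightarrow> (\<forall>j\<in>F. \<forall>v. c j v = 0))"

lemma field_basis_dest:
  assumes "field_basis l A J b"
  shows field_basis_field: "j \<in> J \<Longrightarrow> b j \<in> log_fields l A"
    and field_basis_span: "g \<in> log_fields l A \<Longrightarrow> \<exists>F c. finite F \<and> F \<subseteq> J \<and> (\<forall>j\<in>F. c j \<in> polyfun l) \<and>
        (\<forall>i<l. \<forall>v. g i v = (\<Sum>j\<in>F. c j v * b j i v))"
    and field_basis_indep: "\<lbrakk>finite F; F \<subseteq> J; \<And>j. j \<in> F \<Longrightarrow> c j \<in> polyfun l;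
        \<And>i v. i < l \<Longrightarrow> (\<Sum>j\<in>F. c j v * b j i v) = 0; j \<in> F\<rbrakk> \<Longrightarrow> c j v = 0"
proof -
  show "b j \<in> log_fields l A" if "j \<in> J" using assms that by (simp add: field_basis_def)
  show "\<exists>F c. finite F \<and> F \<subseteq> J \<and> (\<forall>j\<in>F. c j \<in> polyfun l) \<and>
        (\<forall>i<l. \<forall>v. g i v = (\<Sum>j\<in>F. c j v * b j i v))" if "g \<in> log_fields l A"
    using assms that by (simp add: field_basis_def)
  have *: "\<forall>F c. finite F \<and> F \<subseteq> J \<and> (\<forall>j\<in>F. c j \<in> polyfun l) \<and>
        (\<forall>i<l. \<forall>v. (\<Sum>j\<in>F. c j v * b j i v) = 0) \<longrightarrow> (\<forall>j\<in>F. \<forall>v. c j v = 0)"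
    using assms unfolding field_basis_def by (elim conjE)
  show "c j v = 0" if "finite F" "F \<subseteq> J" "\<And>j. j \<in> F \<Longrightarrow> c j \<in> polyfun l"
    "\<And>i v. i < l \<Longrightarrow> (\<Sum>j\<in>F. c j v * b j i v) = 0" "j \<in> F"
    using *[rule_format, of F c j v] that by simp
qed

lemma fields_der_of:
  assumes "arrangement Cplx l A" "g \<in> log_fields l A"
  shows "der_of l g \<in> carrier (LD l A)" "i < l \<Longrightarrow> comps (der_of l g) i = g i"
proof -
  have g: "\<And>i. i < l \<Longrightarrow> g i \<in> polyfun l" "tangent l A g" using assms(2) by (auto simp: log_fields_def)
  have *: "comps (der_of l g) i = g i" if "i < l" for i using ev_der_of[of l g i] g(1) that by blast
  then show "i < l \<Longrightarrow> comps (der_of l g) i = g i" .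
  have "tangent l A (comps (der_of l g))" by (rule tangent_cong[OF _ g(2)]) (simp add: *)
  then show "der_of l g \<in> carrier (LD l A)"
    unfolding LD_carrier[OF assms(1)] using der_of_derivation[of l g] g(1) by blast
qed

lemma comps_fields:
  assumes "arrangement Cplx l A" "\<theta> \<in> carrier (LD l A)"
  shows "comps \<theta> \<in> log_fields l A"
  using assms(2) LD_carrier[OF assms(1)] LD_comp_carrier[OF assms] ev_polyfun
  by (auto simp: log_fields_def)

lemma field_basis_imp_free:
  fixes J :: "'j set"
  assumes A: "arrangement Cplx l A" and b: "field_basis l A J b"
  shows "free_arrangement Cplx l A"
proof -
  define \<delta> where "\<delta> j = der_of l (b j)" for j
  note bf = field_basis_field[OF b]
  have \<delta>: "\<delta> j \<in> carrier (LD l A)" "i < l \<Longrightarrow> comps (\<delta> j) i = b j i" if "j \<in> J" for i j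
    unfolding \<delta>_def using fields_der_of[OF A bf[OF that]] by auto
  have inj: "inj_on \<delta> J"
  proof (rule inj_onI, rule ccontr)
    fix j k assume jk: "j \<in> J" "k \<in> J" "\<delta> j = \<delta> k" "j \<noteq> k"
    then have "b j i = b k i" if "i < l" for i using \<delta>(2) that by metis
    then have "\<And>i v. i < l \<Longrightarrow> (\<Sum>n\<in>{j, k}. (if n = j then 1 else - 1) * b n i v) = 0"
      using jk(4) by simp
    then show False
      using field_basis_indep[OF b, of "{j, k}" "\<lambda>n v. if n = j then 1 else - 1" j] jk
      by (auto intro: polyfun.const)
  qed
  have "free_module (S l) (LD l A)"
    unfolding free_module_def
  proof (intro exI[of _ "\<delta> ` J"] conjI ballI)
    show "\<delta> ` J \<subseteq> carrier (LD l A)" using \<delta>(1) by blast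
    fix x assume x: "x \<in> carrier (LD l A)"
    have rep: "comps (\<Oplus>\<^bsub>LD l A\<^esub>\<beta>\<in>{\<beta> \<in> \<delta> ` J. C \<beta> \<noteq> \<zero>\<^bsub>S l\<^esub>}. C \<beta> \<odot>\<^bsub>LD l A\<^esub> \<beta>) i v
        = (\<Sum>j\<in>F. ev (C (\<delta> j)) v * b j i v)"
      "(\<Oplus>\<^bsub>LD l A\<^esub>\<beta>\<in>{\<beta> \<in> \<delta> ` J. C \<beta> \<noteq> \<zero>\<^bsub>S l\<^esub>}. C \<beta> \<odot>\<^bsub>LD l A\<^esub> \<beta>) \<in> carrier (LD l A)"
      if C: "C \<in> \<delta> ` J \<rightarrow>\<^sub>E carrier (S l)" and F: "finite F" "F \<subseteq> J" "{\<beta> \<in> \<delta> ` J. C \<beta> \<noteq> \<zero>\<^bsub>S l\<^esub>} \<subseteq> \<delta> ` F"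
        and i: "i < l" for C F i v
    proof -
      let ?T = "{\<beta> \<in> \<delta> ` J. C \<beta> \<noteq> \<zero>\<^bsub>S l\<^esub>}"
      have T: "finite ?T" "?T \<subseteq> carrier (LD l A)"
        using finite_subset[OF F(3)] F(1) \<delta>(1) by auto
      have cC: "C \<beta> \<in> carrier (S l)" if "\<beta> \<in> \<delta> ` J" for \<beta> using C that by auto
      show "(\<Oplus>\<^bsub>LD l A\<^esub>\<beta>\<in>?T. C \<beta> \<odot>\<^bsub>LD l A\<^esub> \<beta>) \<in> carrier (LD l A)"
        using cC by (intro LD_combination(1)[OF A T]) auto
      have "comps (\<Oplus>\<^bsub>LD l A\<^esub>\<beta>\<in>?T. C \<beta> \<odot>\<^bsub>LD l A\<^esub> \<beta>) i v = (\<Sum>\<beta>\<in>?T. ev (C \<beta>) v * comps \<beta> i v)"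
        using cC i by (intro LD_combination(2)[OF A T]) auto
      also have "\<dots> = (\<Sum>\<beta>\<in>\<delta> ` F. ev (C \<beta>) v * comps \<beta> i v)"
        using F by (intro sum.mono_neutral_left) auto
      also have "\<dots> = (\<Sum>j\<in>F. ev (C (\<delta> j)) v * comps (\<delta> j) i v)"
        using inj_on_subset[OF inj F(2)] by (simp add: sum.reindex)
      also have "\<dots> = (\<Sum>j\<in>F. ev (C (\<delta> j)) v * b j i v)"
        using F(2) i \<delta>(2) by (intro sum.cong) auto
      finally show "comps (\<Oplus>\<^bsub>LD l A\<^esub>\<beta>\<in>?T. C \<beta> \<odot>\<^bsub>LD l A\<^esub> \<beta>) i v
        = (\<Sum>j\<in>F. ev (C (\<delta> j)) v * b j i v)" .
    qed
    obtain F c where F: "finite F" "F \<subseteq> J" and c: "\<And>j. j \<in> F \<Longrightarrow> c j \<in> polyfun l"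
      and xc: "\<And>i v. i < l \<Longrightarrow> comps x i v = (\<Sum>j\<in>F. c j v * b j i v)"
      using field_basis_span[OF b comps_fields[OF A x]] by blast
    define C where "C = (\<lambda>\<beta>\<in>\<delta> ` J. if \<beta> \<in> \<delta> ` F then poly_of l (c (the_inv_into J \<delta> \<beta>)) else \<zero>\<^bsub>S l\<^esub>)"
    have C\<delta>: "C (\<delta> j) = poly_of l (c j)" if "j \<in> F" for j
    proof -
      have "j \<in> J" using that F(2) by blast
      then show ?thesis using that by (simp add: C_def the_inv_into_f_f[OF inj])
    qed
    have C: "C \<in> \<delta> ` J \<rightarrow>\<^sub>E carrier (S l)"
    proof (rule PiE_I)
      fix \<beta> assume "\<beta> \<in> \<delta> ` J"
      show "C \<beta> \<in> carrier (S l)"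
      proof (cases "\<beta> \<in> \<delta> ` F")
        case True
        then show ?thesis using C\<delta> c poly_of_carrier by auto
      qed (simp add: C_def \<open>\<beta> \<in> \<delta> ` J\<close>)
    qed (simp add: C_def)
    have suppC: "{\<beta> \<in> \<delta> ` J. C \<beta> \<noteq> \<zero>\<^bsub>S l\<^esub>} \<subseteq> \<delta> ` F" by (auto simp: C_def)
    show "\<exists>!c. c \<in> \<delta> ` J \<rightarrow>\<^sub>E carrier (S l) \<and> finite {b \<in> \<delta> ` J. c b \<noteq> \<zero>\<^bsub>S l\<^esub>} \<and>
        x = (\<Oplus>\<^bsub>LD l A\<^esub>b\<in>{b \<in> \<delta> ` J. c b \<noteq> \<zero>\<^bsub>S l\<^esub>}. c b \<odot>\<^bsub>LD l A\<^esub> b)"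
    proof (rule ex1I[of _ C])
      have "x = (\<Oplus>\<^bsub>LD l A\<^esub>b\<in>{b \<in> \<delta> ` J. C b \<noteq> \<zero>\<^bsub>S l\<^esub>}. C b \<odot>\<^bsub>LD l A\<^esub> b)"
      \<comment> \<open>in dimension zero there is no component at which to compare the two sides\<close>
      proof (cases "l = 0")
        case False
        then show ?thesis
          using rep[OF C F suppC] xc C\<delta> c
          by (intro LD_eqI[OF A x]) (auto simp: ev_poly_of intro!: sum.cong)
      next
        case True
        have "(\<Oplus>\<^bsub>LD l A\<^esub>b\<in>{b \<in> \<delta> ` J. C b \<noteq> \<zero>\<^bsub>S l\<^esub>}. C b \<odot>\<^bsub>LD l A\<^esub> b) \<in> carrier (LD l A)"
          using C \<delta>(1) finite_subset[OF suppC] F(1) by (intro LD_combination(1)[OF A]) auto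
        then show ?thesis by (rule LD_eqI[OF A x]) (simp add: True)
      qed
      moreover have "finite {b \<in> \<delta> ` J. C b \<noteq> \<zero>\<^bsub>S l\<^esub>}" using finite_subset[OF suppC] F(1) by simp
      ultimately show "C \<in> \<delta> ` J \<rightarrow>\<^sub>E carrier (S l) \<and> finite {b \<in> \<delta> ` J. C b \<noteq> \<zero>\<^bsub>S l\<^esub>} \<and>
        x = (\<Oplus>\<^bsub>LD l A\<^esub>b\<in>{b \<in> \<delta> ` J. C b \<noteq> \<zero>\<^bsub>S l\<^esub>}. C b \<odot>\<^bsub>LD l A\<^esub> b)" using C by blast
    next
      fix C' assume C': "C' \<in> \<delta> ` J \<rightarrow>\<^sub>E carrier (S l) \<and> finite {b \<in> \<delta> ` J. C' b \<noteq> \<zero>\<^bsub>S l\<^esub>} \<and>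
        x = (\<Oplus>\<^bsub>LD l A\<^esub>b\<in>{b \<in> \<delta> ` J. C' b \<noteq> \<zero>\<^bsub>S l\<^esub>}. C' b \<odot>\<^bsub>LD l A\<^esub> b)"
      define G where "G = F \<union> {j \<in> J. C' (\<delta> j) \<noteq> \<zero>\<^bsub>S l\<^esub>}"
      have "finite {j \<in> J. C' (\<delta> j) \<noteq> \<zero>\<^bsub>S l\<^esub>}"
      proof (rule finite_imageD)
        show "finite (\<delta> ` {j \<in> J. C' (\<delta> j) \<noteq> \<zero>\<^bsub>S l\<^esub>})"
          using C' by (elim conjE) (erule finite_subset[rotated], blast)
        show "inj_on \<delta> {j \<in> J. C' (\<delta> j) \<noteq> \<zero>\<^bsub>S l\<^esub>}" by (rule inj_on_subset[OF inj]) blast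
      qed
      then have G: "finite G" "G \<subseteq> J" using F by (auto simp: G_def)
      have suppC': "{\<beta> \<in> \<delta> ` J. C' \<beta> \<noteq> \<zero>\<^bsub>S l\<^esub>} \<subseteq> \<delta> ` G"
        and suppCG: "{\<beta> \<in> \<delta> ` J. C \<beta> \<noteq> \<zero>\<^bsub>S l\<^esub>} \<subseteq> \<delta> ` G"
        using suppC by (auto simp: G_def)
      have xC': "x = (\<Oplus>\<^bsub>LD l A\<^esub>b\<in>{b \<in> \<delta> ` J. C' b \<noteq> \<zero>\<^bsub>S l\<^esub>}. C' b \<odot>\<^bsub>LD l A\<^esub> b)"
        using C' by (elim conjE)
      have cC: "C (\<delta> j) \<in> carrier (S l)" "C' (\<delta> j) \<in> carrier (S l)" if "j \<in> J" for j
        using C C' that by auto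
      have "C' (\<delta> j) = C (\<delta> j)" if j: "j \<in> J" for j
      proof (cases "j \<in> G")
        case True
        have "ev (C' (\<delta> j)) v - ev (C (\<delta> j)) v = 0" for v
        proof (rule field_basis_indep[OF b G _ _ True, of "\<lambda>j v. ev (C' (\<delta> j)) v - ev (C (\<delta> j)) v"])
          show "(\<lambda>v. ev (C' (\<delta> j)) v - ev (C (\<delta> j)) v) \<in> polyfun l" if "j \<in> G" for j
            using cC that G(2) by (intro polyfun_diff ev_polyfun) auto
          fix i v assume i: "i < l"
          have "(\<Sum>j\<in>G. ev (C' (\<delta> j)) v * b j i v) = comps x i v"
            by (rule rep(1)[OF conjunct1[OF C'] G suppC' i, folded xC', symmetric])
          moreover have "(\<Sum>j\<in>G. ev (C (\<delta> j)) v * b j i v) = (\<Sum>j\<in>F. ev (C (\<delta> j)) v * b j i v)"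
            using rep(1)[OF C G suppCG i, of v] rep(1)[OF C F suppC i, of v] by simp
          moreover have "(\<Sum>j\<in>F. ev (C (\<delta> j)) v * b j i v) = comps x i v"
            using xc[OF i] C\<delta> c by (auto simp: ev_poly_of intro!: sum.cong)
          ultimately show "(\<Sum>j\<in>G. (ev (C' (\<delta> j)) v - ev (C (\<delta> j)) v) * b j i v) = 0"
            by (simp add: left_diff_distrib sum_subtractf)
        qed
        then show ?thesis using cC[OF j] by (intro ev_eqI[of _ l]) auto
      next
        case False
        then show ?thesis using j inj F by (auto simp: G_def C_def inj_on_eq_iff)
      qed
      then show "C' = C" using C C' by (intro PiE_ext[of _ "\<delta> ` J"]) auto
    qed
  qed
  then show ?thesis using A by (simp add: free_arrangement_def)
qed

lemma free_imp_field_basis: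
  assumes "free_arrangement Cplx l A"
  shows "\<exists>B. field_basis l A B comps"
proof -
  have A: "arrangement Cplx l A" using assms by (simp add: free_arrangement_def)
  obtain B where B: "B \<subseteq> carrier (LD l A)"
    and ex1': "\<forall>x\<in>carrier (LD l A). \<exists>!c. c \<in> B \<rightarrow>\<^sub>E carrier (S l) \<and>
        finite {b \<in> B. c b \<noteq> \<zero>\<^bsub>S l\<^esub>} \<and>
        x = (\<Oplus>\<^bsub>LD l A\<^esub>b\<in>{b \<in> B. c b \<noteq> \<zero>\<^bsub>S l\<^esub>}. c b \<odot>\<^bsub>LD l A\<^esub> b)"
    using assms unfolding free_arrangement_def free_module_def by (elim conjE exE)
  note ex1 = ex1'[rule_format]
  have "field_basis l A B comps"
    unfolding field_basis_def
  proof (intro conjI)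
    show "\<forall>\<beta>\<in>B. comps \<beta> \<in> log_fields l A" using comps_fields[OF A] B by blast
  next
    show "\<forall>g\<in>log_fields l A. \<exists>F c. finite F \<and> F \<subseteq> B \<and> (\<forall>j\<in>F. c j \<in> polyfun l) \<and>
        (\<forall>i<l. \<forall>v. g i v = (\<Sum>j\<in>F. c j v * comps j i v))"
    proof
      fix g assume g: "g \<in> log_fields l A"
      note x = fields_der_of[OF A g]
      obtain c where c: "c \<in> B \<rightarrow>\<^sub>E carrier (S l)" "finite {b \<in> B. c b \<noteq> \<zero>\<^bsub>S l\<^esub>}"
          and eq: "der_of l g = (\<Oplus>\<^bsub>LD l A\<^esub>b\<in>{b \<in> B. c b \<noteq> \<zero>\<^bsub>S l\<^esub>}. c b \<odot>\<^bsub>LD l A\<^esub> b)"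
        using ex1[OF x(1)] by (elim ex1E conjE)
      let ?T = "{b \<in> B. c b \<noteq> \<zero>\<^bsub>S l\<^esub>}"
      have cc: "c \<beta> \<in> carrier (S l)" if "\<beta> \<in> ?T" for \<beta> using c(1) that by auto
      have "g i v = (\<Sum>\<beta>\<in>?T. ev (c \<beta>) v * comps \<beta> i v)" if i: "i < l" for i v
      proof -
        have "comps (\<Oplus>\<^bsub>LD l A\<^esub>b\<in>?T. c b \<odot>\<^bsub>LD l A\<^esub> b) i v = (\<Sum>\<beta>\<in>?T. ev (c \<beta>) v * comps \<beta> i v)"
          using B by (intro LD_combination(2)[OF A c(2) _ cc i]) auto
        then show ?thesis using x(2)[OF i] unfolding eq[symmetric] by simp
      qed
      then show "\<exists>F c. finite F \<and> F \<subseteq> B \<and> (\<forall>j\<in>F. c j \<in> polyfun l) \<and>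
          (\<forall>i<l. \<forall>v. g i v = (\<Sum>j\<in>F. c j v * comps j i v))"
        using c(2) cc ev_polyfun by (intro exI[of _ ?T] exI[of _ "\<lambda>\<beta>. ev (c \<beta>)"]) auto
    qed
  next
    show "\<forall>F c. finite F \<and> F \<subseteq> B \<and> (\<forall>j\<in>F. c j \<in> polyfun l) \<and>
        (\<forall>i<l. \<forall>v. (\<Sum>j\<in>F. c j v * comps j i v) = 0) \<longrightarrow> (\<forall>j\<in>F. \<forall>v. c j v = 0)"
    proof (rule allI, rule allI, rule impI)
      fix F :: "((nat multiset \<Rightarrow> complex) \<Rightarrow> (nat multiset \<Rightarrow> complex)) set" and c
      assume *: "finite F \<and> F \<subseteq> B \<and> (\<forall>j\<in>F. c j \<in> polyfun l) \<and>
          (\<forall>i<l. \<forall>v. (\<Sum>j\<in>F. c j v * comps j i v) = 0)"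
      show "\<forall>\<beta>\<in>F. \<forall>v. c \<beta> v = 0"
      proof (intro ballI allI)
        fix \<beta> v assume \<beta>: "\<beta> \<in> F"
        \<comment> \<open>the given relation and the trivial one are two expansions of zero\<close>
        define C where "C = (\<lambda>\<beta>\<in>B. if \<beta> \<in> F then poly_of l (c \<beta>) else \<zero>\<^bsub>S l\<^esub>)"
        define Z where "Z = (\<lambda>\<beta>\<in>B. \<zero>\<^bsub>S l\<^esub>)"
        have Cc: "C \<beta> \<in> carrier (S l)" "ev (C \<beta>) = c \<beta>" if "\<beta> \<in> F" for \<beta>
          using that * by (auto simp: C_def poly_of_carrier ev_poly_of)
        have C: "C \<in> B \<rightarrow>\<^sub>E carrier (S l)"
        proof (rule PiE_I)
          show "C \<beta> \<in> carrier (S l)" if "\<beta> \<in> B" for \<beta>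
            by (cases "\<beta> \<in> F") (rule Cc(1), assumption, simp add: C_def that)
        qed (simp add: C_def)
        let ?T = "{b \<in> B. C b \<noteq> \<zero>\<^bsub>S l\<^esub>}"
        have TF: "?T \<subseteq> F" by (auto simp: C_def)
        have T: "finite ?T" using finite_subset[OF TF] * by simp
        have TB: "?T \<subseteq> carrier (LD l A)" using B by auto
        have cT: "C \<beta> \<in> carrier (S l)" if "\<beta> \<in> ?T" for \<beta> using C that by auto
        have zC: "\<zero>\<^bsub>LD l A\<^esub> = (\<Oplus>\<^bsub>LD l A\<^esub>b\<in>?T. C b \<odot>\<^bsub>LD l A\<^esub> b)"
        proof (rule LD_eqI[OF A LD_zero[OF A] LD_combination(1)[OF A T TB cT]])
          fix i v assume i: "i < l"
          have "comps (\<Oplus>\<^bsub>LD l A\<^esub>b\<in>?T. C b \<odot>\<^bsub>LD l A\<^esub> b) i v = (\<Sum>\<beta>\<in>?T. ev (C \<beta>) v * comps \<beta> i v)"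
            by (rule LD_combination(2)[OF A T TB cT i])
          also have "\<dots> = (\<Sum>\<beta>\<in>F. ev (C \<beta>) v * comps \<beta> i v)"
            using * TF by (intro sum.mono_neutral_left) auto
          also have "\<dots> = 0" using * i Cc(2) by simp
          finally show "comps \<zero>\<^bsub>LD l A\<^esub> i v = comps (\<Oplus>\<^bsub>LD l A\<^esub>b\<in>?T. C b \<odot>\<^bsub>LD l A\<^esub> b) i v"
            using comps_zero[OF A LD_zero[OF A] i] by simp
        qed
        have zZ: "\<zero>\<^bsub>LD l A\<^esub> = (\<Oplus>\<^bsub>LD l A\<^esub>b\<in>{b \<in> B. Z b \<noteq> \<zero>\<^bsub>S l\<^esub>}. Z b \<odot>\<^bsub>LD l A\<^esub> b)"
        proof -
          interpret abelian_monoid "LD l A" by (rule abelian_monoid_LD[OF A])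
          have "{b \<in> B. Z b \<noteq> \<zero>\<^bsub>S l\<^esub>} = {}" by (auto simp: Z_def)
          then show ?thesis by (simp only: finsum_empty)
        qed
        have Z: "Z \<in> B \<rightarrow>\<^sub>E carrier (S l)" "finite {b \<in> B. Z b \<noteq> \<zero>\<^bsub>S l\<^esub>}" by (auto simp: Z_def)
        obtain c\<^sub>0 where u: "\<forall>c. c \<in> B \<rightarrow>\<^sub>E carrier (S l) \<and> finite {b \<in> B. c b \<noteq> \<zero>\<^bsub>S l\<^esub>} \<and>
            \<zero>\<^bsub>LD l A\<^esub> = (\<Oplus>\<^bsub>LD l A\<^esub>b\<in>{b \<in> B. c b \<noteq> \<zero>\<^bsub>S l\<^esub>}. c b \<odot>\<^bsub>LD l A\<^esub> b) \<longrightarrow> c = c\<^sub>0"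
          using ex1[OF LD_zero[OF A]] by (elim ex1E)
        have "C = c\<^sub>0" by (rule u[rule_format]) (intro conjI C T zC)
        moreover have "Z = c\<^sub>0" by (rule u[rule_format]) (intro conjI Z zZ)
        ultimately have "C = Z" by simp
        then have "C \<beta> = \<zero>\<^bsub>S l\<^esub>" using \<beta> * by (auto simp: Z_def)
        moreover have "c \<beta> v = ev (C \<beta>) v" by (simp only: Cc(2)[OF \<beta>])
        ultimately show "c \<beta> v = 0" by simp
      qed
    qed
  qed
  then show ?thesis by (rule exI)
qed

section \<open>Adding hyperplanes and changing bases\<close>

lemma tangent_insert:
  "tangent l (insert (form_kernel Cplx l a) A) g \<longleftrightarrow>
     tangent l A g \<and> (\<forall>v. dot l a v = 0 \<longrightarrow> dot l a (\<lambda>i. g i v) = 0)"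
  unfolding tangent_def by (simp only: ball_simps kernel_iff conj_commute)

lemma arrangement_insert:
  assumes "arrangement Cplx l A" "\<exists>i<l. a i \<noteq> 0"
  shows "arrangement Cplx l (insert (form_kernel Cplx l a) A)"
proof -
  have "form_kernel Cplx l (restrict a {..<l}) = form_kernel Cplx l a"
    by (rule kernel_eqI) (simp add: dot_def)
  then have "defines_hyperplane Cplx l (restrict a {..<l}) (form_kernel Cplx l a)"
    using assms(2) by (auto simp: defines_hyperplane_iff)
  then show ?thesis using assms(1) unfolding arrangement_def by blast
qed

lemma dot_zero [simp]: "dot l a (\<lambda>i. 0) = 0"
  by (simp add: dot_def)

text \<open>The addition step. A field tangent also to the new hyperplane \<open>H\<close> is a combination of the old
  basis. All old basis fields but the \<open>j\<close>-th are tangent to \<open>H\<close>, so on \<open>H\<close> the product of the \<open>j\<close>-th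
  coefficient with a function that does not vanish identically is zero. Hence this coefficient is
  divisible by the form of \<open>H\<close>, and the form can be moved into the basis field. The \<open>j\<close>-th field is
  tangent to the old hyperplanes but not to \<open>H\<close>, which therefore is really new.\<close>

lemma field_basis_add:
  fixes b b' :: "'j \<Rightarrow> nat \<Rightarrow> (nat \<Rightarrow> complex) \<Rightarrow> complex"
  assumes A: "arrangement Cplx l A" and b: "field_basis l A J b" and j: "j \<in> J"
    and tan: "\<And>k v. \<lbrakk>k \<in> J; k \<noteq> j; dot l a v = 0\<rbrakk> \<Longrightarrow> dot l a (\<lambda>i. b k i v) = 0"
    and u: "dot l a u = 0" "dot l a (\<lambda>i. b j i u) \<noteq> 0"
    and b': "\<And>i v. i < l \<Longrightarrow> b' j i v = dot l a v * b j i v"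
      "\<And>k i v. \<lbrakk>k \<in> J; k \<noteq> j; i < l\<rbrakk> \<Longrightarrow> b' k i v = b k i v"
  shows "form_kernel Cplx l a \<notin> A"
    and "arrangement Cplx l (insert (form_kernel Cplx l a) A)"
    and "field_basis l (insert (form_kernel Cplx l a) A) J b'"
proof -
  have bj: "\<And>i. i < l \<Longrightarrow> b k i \<in> polyfun l" "tangent l A (b k)" if "k \<in> J" for k
    using field_basis_field[OF b that] by (auto simp: log_fields_def)
  show "form_kernel Cplx l a \<notin> A"
  proof
    assume "form_kernel Cplx l a \<in> A"
    then show False using bj(2)[OF j] u unfolding tangent_iff[OF A] by blast
  qed
  have nz: "\<exists>i<l. a i \<noteq> 0"
  proof (rule ccontr)
    assume "\<not> ?thesis"
    then show False using u(2) by (simp add: dot_def)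
  qed
  then show A': "arrangement Cplx l (insert (form_kernel Cplx l a) A)"
    by (intro arrangement_insert A)
  have \<alpha>b: "(\<lambda>v. dot l a (\<lambda>i. b j i v)) \<in> polyfun l" using bj(1)[OF j] by (rule polyfun_dot)
  have mem: "\<forall>k\<in>J. b' k \<in> log_fields l (insert (form_kernel Cplx l a) A)"
  proof
    fix k assume k: "k \<in> J"
    show "b' k \<in> log_fields l (insert (form_kernel Cplx l a) A)"
    proof (cases "k = j")
      case False
      have eq: "b' k i = b k i" if "i < l" for i using b'(2)[OF k False that] by blast
      have "tangent l (insert (form_kernel Cplx l a) A) (b k)"
        using bj(2)[OF k] tan[OF k False] by (simp add: tangent_insert)
      then have "tangent l (insert (form_kernel Cplx l a) A) (b' k)"
        by (rule tangent_cong[rotated]) (simp add: eq)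
      then show ?thesis using bj(1)[OF k] eq by (simp add: log_fields_def)
    next
      case True
      have eq: "b' j i = (\<lambda>v. dot l a v * b j i v)" if "i < l" for i using b'(1)[OF that] by blast
      have "dot l a (\<lambda>i. dot l a v * b j i v) = dot l a v * dot l a (\<lambda>i. b j i v)" for v
        unfolding dot_def[of l a "\<lambda>i. b j i v"] dot_def[of l a "\<lambda>i. dot l a v * b j i v"]
        by (simp add: sum_distrib_left mult_ac)
      then have "tangent l (insert (form_kernel Cplx l a) A) (\<lambda>i v. dot l a v * b j i v)"
        using tangent_scale[OF A bj(2)[OF j]] by (simp add: tangent_insert)
      then have "tangent l (insert (form_kernel Cplx l a) A) (b' j)"
        by (rule tangent_cong[rotated]) (simp add: eq)
      then show ?thesis using bj(1)[OF j] eq True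
        by (auto simp: log_fields_def intro!: polyfun_mult polyfun_dot_id)
    qed
  qed
  have span: "\<exists>F c. finite F \<and> F \<subseteq> J \<and> (\<forall>k\<in>F. c k \<in> polyfun l) \<and>
        (\<forall>i<l. \<forall>v. g i v = (\<Sum>k\<in>F. c k v * b' k i v))"
    if g: "g \<in> log_fields l (insert (form_kernel Cplx l a) A)" for g
  proof -
    have gA: "g \<in> log_fields l A" and ga: "\<And>v. dot l a v = 0 \<Longrightarrow> dot l a (\<lambda>i. g i v) = 0"
      using g by (auto simp: log_fields_def tangent_insert)
    obtain F c where F: "finite F" "F \<subseteq> J" and c: "\<forall>k\<in>F. c k \<in> polyfun l"
      and gc: "\<forall>i<l. \<forall>v. g i v = (\<Sum>k\<in>F. c k v * b k i v)"
      using field_basis_span[OF b gA] by (elim exE conjE)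
    show ?thesis
    proof (cases "j \<in> F")
      case False
      have "b' k i v = b k i v" if "k \<in> F" "i < l" for k i v
        using b'(2) that False F(2) by blast
      then have "g i v = (\<Sum>k\<in>F. c k v * b' k i v)" if "i < l" for i v
        using gc that by simp
      then show ?thesis using F c by blast
    next
      case True
      have "c j v * dot l a (\<lambda>i. b j i v) = 0" if v: "dot l a v = 0" for v
      proof -
        have "0 = dot l a (\<lambda>i. \<Sum>k\<in>F. c k v * b k i v)"
          using ga[OF v] gc by (simp add: dot_def)
        also have "\<dots> = (\<Sum>k\<in>F. c k v * dot l a (\<lambda>i. b k i v))"
          unfolding dot_def sum_distrib_left by (subst sum.swap) (simp add: mult_ac)
        also have "\<dots> = (\<Sum>k\<in>F. if k = j then c j v * dot l a (\<lambda>i. b j i v) else 0)"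
          using tan[OF _ _ v] F(2) by (intro sum.cong) auto
        also have "\<dots> = c j v * dot l a (\<lambda>i. b j i v)" using F True by simp
        finally show ?thesis by simp
      qed
      then have "(\<forall>v\<in>{v. dot l a v = 0}. c j v = 0) \<or>
          (\<forall>v\<in>{v. dot l a v = 0}. dot l a (\<lambda>i. b j i v) = 0)"
        using c True \<alpha>b by (intro polyfun_no_zero_divisors[of _ l]) (auto simp: dot_kernel_line)
      then have 0: "c j v = 0" if "dot l a v = 0" for v using u that by auto
      obtain n where n: "n < l" "a n \<noteq> 0" using nz by blast
      obtain q where q: "q \<in> polyfun l" "\<And>v. c j v = dot l a v * q v"
        using polyfun_dvd[where f="c j" and a=a and j=n, OF c[rule_format, OF True] n 0] by blast
      have "c k v * b k i v = (c(j := q)) k v * b' k i v" if "k \<in> F" "i < l" for k i v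
        using b' q(2) F(2) that by (cases "k = j") (auto simp: subset_iff)
      then have "g i v = (\<Sum>k\<in>F. (c(j := q)) k v * b' k i v)" if "i < l" for i v
        using gc that by simp
      moreover have "\<forall>k\<in>F. (c(j := q)) k \<in> polyfun l" using c q(1) by simp
      ultimately show ?thesis using F by blast
    qed
  qed
  have indep: "\<forall>k\<in>F. \<forall>v. c k v = 0"
    if F: "finite F" "F \<subseteq> J" and c: "\<forall>k\<in>F. c k \<in> polyfun l"
      and 0: "\<forall>i<l. \<forall>v. (\<Sum>k\<in>F. c k v * b' k i v) = 0" for F c
  proof (intro ballI allI)
    fix k v assume k: "k \<in> F"
    define d where "d k = (if k = j then (\<lambda>v. c j v * dot l a v) else c k)" for k
    have d: "d k v = 0" if "k \<in> F" for k v
    proof (rule field_basis_indep[where c=d, OF b F _ _ that])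
      show "d k \<in> polyfun l" if "k \<in> F" for k
        unfolding d_def using c that by (auto intro!: polyfun_mult polyfun_dot_id)
      fix i v assume i: "i < l"
      have "(\<Sum>k\<in>F. d k v * b k i v) = (\<Sum>k\<in>F. c k v * b' k i v)"
      proof (rule sum.cong[OF refl])
        fix k assume "k \<in> F"
        then show "d k v * b k i v = c k v * b' k i v"
          using b' i F(2) by (cases "k = j") (auto simp: d_def subset_iff)
      qed
      then show "(\<Sum>k\<in>F. d k v * b k i v) = 0" using 0 i by simp
    qed
    show "c k v = 0"
    proof (cases "k = j")
      case True
      obtain w where w: "dot l a w \<noteq> 0" using nz dot_nonzero by blast
      show ?thesis
        using polyfun_cancel[OF polyfun_dot_id _ _ w, of "c j" v] c k True d[of j]
        by (simp add: d_def mult.commute)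
    qed (use d[OF k] in \<open>simp add: d_def\<close>)
  qed
  show "field_basis l (insert (form_kernel Cplx l a) A) J b'"
    unfolding field_basis_def
    by (intro conjI ballI mem span) (assumption, intro allI impI, elim conjE, rule indep)
qed

lemma sum_swap3:
  fixes x y z :: "_ \<Rightarrow> complex"
  shows "(\<Sum>j\<in>J. x j * (\<Sum>k\<in>K. y' j k * z k)) = (\<Sum>k\<in>K. (\<Sum>j\<in>J. x j * y' j k) * z k)"
  unfolding sum_distrib_left sum_distrib_right by (subst sum.swap) (simp add: mult.assoc)

lemma field_basis_change:
  fixes b b' :: "'j \<Rightarrow> nat \<Rightarrow> (nat \<Rightarrow> complex) \<Rightarrow> complex"
  assumes A: "arrangement Cplx l A" and b: "field_basis l A J b" and J: "finite J"
    and M: "\<And>j k. \<lbrakk>j \<in> J; k \<in> J\<rbrakk> \<Longrightarrow> M j k \<in> polyfun l"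
    and N: "\<And>j k. \<lbrakk>j \<in> J; k \<in> J\<rbrakk> \<Longrightarrow> N j k \<in> polyfun l"
    and MN: "\<And>j k v. \<lbrakk>j \<in> J; k \<in> J\<rbrakk> \<Longrightarrow> (\<Sum>m\<in>J. M j m v * N m k v) = (if j = k then 1 else 0)"
    and NM: "\<And>j k v. \<lbrakk>j \<in> J; k \<in> J\<rbrakk> \<Longrightarrow> (\<Sum>m\<in>J. N j m v * M m k v) = (if j = k then 1 else 0)"
    and b': "\<And>j i v. \<lbrakk>j \<in> J; i < l\<rbrakk> \<Longrightarrow> b' j i v = (\<Sum>k\<in>J. M j k v * b k i v)"
  shows "field_basis l A J b'"
proof -
  have bj: "\<And>i. i < l \<Longrightarrow> b k i \<in> polyfun l" "tangent l A (b k)" if "k \<in> J" for k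
    using field_basis_field[OF b that] by (auto simp: log_fields_def)
  have mem: "b' j \<in> log_fields l A" if j: "j \<in> J" for j
  proof -
    have eq: "b' j i = (\<lambda>v. \<Sum>k\<in>J. M j k v * b k i v)" if "i < l" for i using b'[OF j that] by blast
    have "tangent l A (\<lambda>i v. \<Sum>k\<in>K. M j k v * b k i v)" if "finite K" "K \<subseteq> J" for K
      using that
      by (induction K rule: finite_induct)
         (auto intro!: tangent_zero tangent_add tangent_scale A bj(2))
    from this[OF J] have "tangent l A (b' j)" by (rule tangent_cong[rotated]) (simp_all add: eq)
    then show ?thesis using bj(1) M[OF j] eq by (auto simp: log_fields_def intro!: polyfun_sum polyfun_mult)
  qed
  have bN: "b j i v = (\<Sum>k\<in>J. N j k v * b' k i v)" if "j \<in> J" "i < l" for j i v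
  proof -
    have "(\<Sum>k\<in>J. N j k v * b' k i v) = (\<Sum>k\<in>J. N j k v * (\<Sum>m\<in>J. M k m v * b m i v))"
      using b' that by simp
    also have "\<dots> = (\<Sum>m\<in>J. (\<Sum>k\<in>J. N j k v * M k m v) * b m i v)" by (rule sum_swap3)
    also have "\<dots> = b j i v" using NM that J by (simp add: if_distrib[of "\<lambda>x. x * _"] cong: if_cong)
    finally show ?thesis by simp
  qed
  have span: "\<exists>F c. finite F \<and> F \<subseteq> J \<and> (\<forall>k\<in>F. c k \<in> polyfun l) \<and>
        (\<forall>i<l. \<forall>v. g i v = (\<Sum>k\<in>F. c k v * b' k i v))" if g: "g \<in> log_fields l A" for g
  proof -
    obtain F c where F: "finite F" "F \<subseteq> J" and c: "\<forall>k\<in>F. c k \<in> polyfun l"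
      and gc: "\<forall>i<l. \<forall>v. g i v = (\<Sum>k\<in>F. c k v * b k i v)"
      using field_basis_span[OF b g] by (elim exE conjE)
    let ?d = "\<lambda>k v. \<Sum>j\<in>F. c j v * N j k v"
    have "g i v = (\<Sum>k\<in>J. ?d k v * b' k i v)" if i: "i < l" for i v
    proof -
      have "g i v = (\<Sum>j\<in>F. c j v * (\<Sum>k\<in>J. N j k v * b' k i v))"
        using gc i bN F(2) by (auto intro!: sum.cong)
      also have "\<dots> = (\<Sum>k\<in>J. ?d k v * b' k i v)" by (rule sum_swap3)
      finally show ?thesis .
    qed
    moreover have "\<forall>k\<in>J. ?d k \<in> polyfun l"
      using c N F(2) by (auto intro!: polyfun_sum polyfun_mult)
    ultimately show ?thesis using J by (intro exI[of _ J] exI[of _ ?d]) simp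
  qed
  have indep: "\<forall>k\<in>F. \<forall>v. c k v = 0"
    if F: "finite F" "F \<subseteq> J" and c: "\<forall>k\<in>F. c k \<in> polyfun l"
      and 0: "\<forall>i<l. \<forall>v. (\<Sum>k\<in>F. c k v * b' k i v) = 0" for F c
  proof (intro ballI allI)
    fix n v assume n: "n \<in> F"
    have d: "(\<Sum>j\<in>F. c j v * M j k v) = 0" if "k \<in> J" for k
    proof (rule field_basis_indep[where c="\<lambda>k v. \<Sum>j\<in>F. c j v * M j k v", OF b J order_refl _ _ that])
      show "(\<lambda>v. \<Sum>j\<in>F. c j v * M j k v) \<in> polyfun l" if "k \<in> J" for k
        using c M F(2) that by (auto intro!: polyfun_sum polyfun_mult)
      fix i v assume i: "i < l"
      have "(\<Sum>k\<in>J. (\<Sum>j\<in>F. c j v * M j k v) * b k i v) = (\<Sum>j\<in>F. c j v * (\<Sum>k\<in>J. M j k v * b k i v))"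
        by (rule sum_swap3[symmetric])
      also have "\<dots> = (\<Sum>j\<in>F. c j v * b' j i v)"
        using b' i F(2) by (auto intro!: sum.cong)
      finally show "(\<Sum>k\<in>J. (\<Sum>j\<in>F. c j v * M j k v) * b k i v) = 0" using 0 i by simp
    qed
    have "c n v = (\<Sum>j\<in>F. if j = n then c n v else 0)" using F n by simp
    also have "\<dots> = (\<Sum>j\<in>F. c j v * (\<Sum>k\<in>J. M j k v * N k n v))"
    proof (rule sum.cong[OF refl])
      fix j assume "j \<in> F"
      then have "(\<Sum>k\<in>J. M j k v * N k n v) = (if j = n then 1 else 0)" using MN F(2) n by blast
      then show "(if j = n then c n v else 0) = c j v * (\<Sum>k\<in>J. M j k v * N k n v)" by simp
    qed
    also have "\<dots> = (\<Sum>k\<in>J. (\<Sum>j\<in>F. c j v * M j k v) * N k n v)" by (rule sum_swap3)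
    also have "\<dots> = 0" using d by simp
    finally show "c n v = 0" .
  qed
  show ?thesis
    unfolding field_basis_def
    by (intro conjI ballI mem span) (assumption, assumption, intro allI impI, elim conjE, rule indep)
qed

lemma field_basis_empty: "field_basis l {} {..<l} (\<lambda>j i v. if i = j then 1 else 0)"
proof -
  have span: "\<exists>F c. finite F \<and> F \<subseteq> {..<l} \<and> (\<forall>k\<in>F. c k \<in> polyfun l) \<and>
        (\<forall>i<l. \<forall>v. g i v = (\<Sum>k\<in>F. c k v * (if i = k then 1 else 0)))" if "g \<in> log_fields l {}" for g
    using that by (intro exI[of _ "{..<l}"] exI[of _ g]) (auto simp: log_fields_def if_distrib cong: if_cong)
  have indep: "\<forall>k\<in>F. \<forall>v. c k v = 0"
    if F: "finite F" "F \<subseteq> {..<l}" and c: "\<forall>k\<in>F. c k \<in> polyfun l"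
      and 0: "\<forall>i<l. \<forall>v. (\<Sum>k\<in>F. c k v * (if i = k then 1 else 0)) = 0" for F and c :: "nat \<Rightarrow> _"
  proof (intro ballI allI)
    fix k v assume k: "k \<in> F"
    then have "(\<Sum>n\<in>F. c n v * (if k = n then 1 else 0)) = 0" using 0 F(2) by auto
    then show "c k v = 0" using F(1) k by (simp add: if_distrib cong: if_cong)
  qed
  have mem: "(\<lambda>i v. if i = j then 1 else 0) \<in> log_fields l {}" for j :: nat
    by (auto simp: log_fields_def tangent_def intro: polyfun.const)
  show ?thesis
    unfolding field_basis_def
    by (intro conjI ballI mem span) (assumption, intro allI impI, elim conjE, rule indep)
qed

lemma additionally_free_empty: "additionally_free Cplx l {}"
proof -
  have A: "arrangement Cplx l {}" by (simp add: arrangement_def)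
  show ?thesis
    unfolding additionally_free_def
    using A field_basis_imp_free[OF A field_basis_empty] by (intro conjI exI[of _ "\<lambda>_. {}"]) auto
qed

lemma additionally_free_insert:
  assumes "additionally_free Cplx l A" "H \<notin> A" "free_arrangement Cplx l (insert H A)"
  shows "additionally_free Cplx l (insert H A)"
proof -
  obtain F where F: "F 0 = {}" "F (card A) = A" "\<forall>i<card A. F i \<subset> F (Suc i)"
    "\<forall>i\<le>card A. free_arrangement Cplx l (F i) \<and> card (F i) = i"
    using assms(1) unfolding additionally_free_def by (elim conjE exE)
  have fin: "finite A" using assms(1) by (simp add: additionally_free_def arrangement_def)
  then have card: "card (insert H A) = Suc (card A)" using assms(2) by simp
  define G where "G i = (if i \<le> card A then F i else insert H A)" for i
  have "G 0 = {}" "G (card (insert H A)) = insert H A" by (auto simp: G_def F card)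
  moreover have "\<forall>i<card (insert H A). G i \<subset> G (Suc i)"
  proof (intro allI impI)
    fix i assume "i < card (insert H A)"
    then consider "i < card A" | "i = card A" using card by linarith
    then show "G i \<subset> G (Suc i)"
      by cases (use F assms(2) in \<open>auto simp: G_def\<close>)
  qed
  moreover have "\<forall>i\<le>card (insert H A). free_arrangement Cplx l (G i) \<and> card (G i) = i"
    using F(4) assms(3) card by (auto simp: G_def le_Suc_eq)
  moreover have "arrangement Cplx l (insert H A)" using assms(3) by (simp add: free_arrangement_def)
  ultimately show ?thesis unfolding additionally_free_def by (intro conjI exI[of _ G])
qed

section \<open>The arrangement in dimension four\<close>

definition inf_form :: "nat \<Rightarrow> complex" where
  "inf_form = (\<lambda>i. if i = 3 then 1 else 0)"

definition coord_form :: "nat \<Rightarrow> complex \<Rightarrow> nat \<Rightarrow> complex" where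
  "coord_form j t = (\<lambda>i. if i = j then 1 else if i = 3 then - t else 0)"

definition pair_form :: "nat \<Rightarrow> nat \<Rightarrow> complex" where
  "pair_form j = (\<lambda>i. if i = j \<or> i = (j + 1) mod 3 then 1 else 0)"

lemmas form_defs = inf_form_def coord_form_def pair_form_def

text \<open>With the coordinates \<open>x, y, z, w\<close>, the numbering is \<open>x = 0\<close>, \<open>y = 1\<close>, \<open>z = 2\<close> and \<open>w = 3\<close>. The forms are
  listed in reverse order of their addition: \<open>w\<close>, then \<open>x - w\<close>, \<open>x + w\<close> and likewise for \<open>y\<close> and \<open>z\<close>, then
  \<open>x + y\<close>, \<open>y + z\<close> and \<open>z + x\<close>.\<close>

definition ten_forms :: "(nat \<Rightarrow> complex) set" where
  "ten_forms = {pair_form 2, pair_form 1, pair_form 0,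
     coord_form 2 (-1), coord_form 2 1, coord_form 1 (-1), coord_form 1 1,
     coord_form 0 (-1), coord_form 0 1, inf_form}"

text \<open>Field number 3 is the Euler field, which is tangent to every central hyperplane. As long as no
  form mixes \<open>x\<close>, \<open>y\<close> and \<open>z\<close>, the others can be chosen along the coordinate axes.\<close>

definition diag_fields ::
    "(nat \<Rightarrow> (nat \<Rightarrow> complex) \<Rightarrow> complex) \<Rightarrow> nat \<Rightarrow> nat \<Rightarrow> (nat \<Rightarrow> complex) \<Rightarrow> complex" where
  "diag_fields c j i v = (if j = 3 then v i else if i = j then c i v else 0)"

text \<open>The fields \<open>s\<^sub>0 (F, G, -H)\<close>, \<open>s\<^sub>1 (-F, G, H)\<close> and \<open>s\<^sub>2 (F, -G, H)\<close>, where \<open>F = x\<^sup>2 - w\<^sup>2\<close>, \<open>G = y\<^sup>2 - w\<^sup>2\<close> and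
  \<open>H = z\<^sup>2 - w\<^sup>2\<close>, next to the Euler field. Two of the components of field \<open>j\<close> carry the same sign; they are
  those at the two variables of \<open>pair_form j\<close>.\<close>

definition mixed_fields ::
    "(nat \<Rightarrow> (nat \<Rightarrow> complex) \<Rightarrow> complex) \<Rightarrow> nat \<Rightarrow> nat \<Rightarrow> (nat \<Rightarrow> complex) \<Rightarrow> complex" where
  "mixed_fields s j i v =
     (if j = 3 then v i else if i = 3 then 0
      else s j v * (if i = (j + 2) mod 3 then - 1 else 1) * ((v i)\<^sup>2 - (v 3)\<^sup>2))"

definition af_basis ::
    "(nat \<Rightarrow> complex) set set \<Rightarrow> (nat \<Rightarrow> nat \<Rightarrow> (nat \<Rightarrow> complex) \<Rightarrow> complex) \<Rightarrow> bool" where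
  "af_basis A b \<longleftrightarrow> additionally_free Cplx 4 A \<and> field_basis 4 A {..<4} b"

lemma sum4: "(\<Sum>i<4::nat. f i) = f 0 + f 1 + f 2 + (f 3 :: complex)"
  by (simp add: eval_nat_numeral)

lemma dot4: "dot 4 a v = a 0 * v 0 + a 1 * v 1 + a 2 * v 2 + a 3 * v 3"
  unfolding dot_def by (rule sum4)

lemma less3: "j < 3 \<longleftrightarrow> j = 0 \<or> j = 1 \<or> j = (2::nat)" and less4: "j < 4 \<longleftrightarrow> j < 3 \<or> j = (3::nat)"
  by auto

lemma af_basis_add:
  assumes "af_basis A b" "j < 4"
    and "\<And>k v. \<lbrakk>k < 4; k \<noteq> j; dot 4 a v = 0\<rbrakk> \<Longrightarrow> dot 4 a (\<lambda>i. b k i v) = 0"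
    and "dot 4 a u = 0" "dot 4 a (\<lambda>i. b j i u) \<noteq> 0"
    and "\<And>i v. i < 4 \<Longrightarrow> b' j i v = dot 4 a v * b j i v"
      "\<And>k i v. \<lbrakk>k < 4; k \<noteq> j; i < 4\<rbrakk> \<Longrightarrow> b' k i v = b k i v"
  shows "af_basis (insert (form_kernel Cplx 4 a) A) b'"
proof -
  have A: "arrangement Cplx 4 A" and b: "field_basis 4 A {..<4} b" and af: "additionally_free Cplx 4 A"
    using assms(1) by (auto simp: af_basis_def additionally_free_def)
  note add = field_basis_add[where b'=b', OF A b _ _ assms(4,5), of]
  have 1: "form_kernel Cplx 4 a \<notin> A" by (rule add(1)) (use assms in auto)
  have 2: "arrangement Cplx 4 (insert (form_kernel Cplx 4 a) A)" by (rule add(2)) (use assms in auto)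
  have 3: "field_basis 4 (insert (form_kernel Cplx 4 a) A) {..<4} b'" by (rule add(3)) (use assms in auto)
  show ?thesis
    unfolding af_basis_def
    using additionally_free_insert[OF af 1 field_basis_imp_free[OF 2 3]] 3 by blast
qed

lemma af_basis_change:
  assumes "af_basis A b"
    and "\<And>j k. \<lbrakk>j < 4; k < 4\<rbrakk> \<Longrightarrow> M j k \<in> polyfun 4" "\<And>j k. \<lbrakk>j < 4; k < 4\<rbrakk> \<Longrightarrow> N j k \<in> polyfun 4"
    and "\<And>j k v. \<lbrakk>j < 4; k < 4\<rbrakk> \<Longrightarrow> (\<Sum>m<4. M j m v * N m k v) = (if j = k then 1 else 0)"
    and "\<And>j k v. \<lbrakk>j < 4; k < 4\<rbrakk> \<Longrightarrow> (\<Sum>m<4. N j m v * M m k v) = (if j = k then 1 else 0)"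
    and "\<And>j i v. \<lbrakk>j < 4; i < 4\<rbrakk> \<Longrightarrow> b' j i v = (\<Sum>k<4. M j k v * b k i v)"
  shows "af_basis A b'"
proof -
  have "field_basis 4 A {..<4} b'"
    by (rule field_basis_change[where b=b and M=M and N=N])
       (use assms in \<open>auto simp: af_basis_def additionally_free_def\<close>)
  then show ?thesis using assms(1) by (simp add: af_basis_def)
qed

lemma af_basis_inf: "af_basis {form_kernel Cplx 4 inf_form} (diag_fields (\<lambda>_ _. 1))"
proof -
  let ?b = "\<lambda>j i v. if i = j then 1 else (0::complex)"
    and ?b' = "\<lambda>j i v. if i = j then if i = 3 then v (3::nat) else 1 else (0::complex)"
  have 0: "af_basis {} ?b"
    unfolding af_basis_def using additionally_free_empty field_basis_empty by blast
  have 1: "af_basis {form_kernel Cplx 4 inf_form} ?b'"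
    by (rule af_basis_add[OF 0, of 3 inf_form "\<lambda>_. 0"]) (auto simp: dot4 inf_form_def)
  define M :: "complex \<Rightarrow> nat \<Rightarrow> nat \<Rightarrow> (nat \<Rightarrow> complex) \<Rightarrow> complex"
    where "M t j k = (if j = k then (\<lambda>_. 1) else if j = 3 then (\<lambda>v. t * v k) else (\<lambda>_. 0))" for t j k
  show ?thesis
  proof (rule af_basis_change[OF 1, of "M 1" "M (-1)"])
    show "M 1 j k \<in> polyfun 4" "M (-1) j k \<in> polyfun 4" if "j < 4" "k < 4" for j k
      using that by (auto simp: M_def intro!: polyfun_intros)
    show "(\<Sum>m<4. M 1 j m v * M (-1) m k v) = (if j = k then 1 else 0)"
      "(\<Sum>m<4. M (-1) j m v * M 1 m k v) = (if j = k then 1 else 0)" if "j < 4" "k < 4" for j k v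
      using that unfolding less4 less3 sum4 by (elim disjE; simp add: M_def)+
    show "diag_fields (\<lambda>_ _. 1) j i v = (\<Sum>k<4. M 1 j k v * ?b' k i v)" if "j < 4" "i < 4" for j i v
      using that unfolding less4 less3 sum4 by (elim disjE; simp add: M_def diag_fields_def)
  qed
qed

lemma af_basis_coord:
  assumes "af_basis A (diag_fields c)" "j < 3" "u j = t * u 3" "c j u \<noteq> 0"
  shows "af_basis (insert (form_kernel Cplx 4 (coord_form j t)) A)
           (diag_fields (c(j := (\<lambda>v. (v j - t * v 3) * c j v))))"
proof (rule af_basis_add[OF assms(1), of j _ u])
  show "j < 4" using assms(2) by simp
  have d: "dot 4 (coord_form j t) v = v j - t * v 3" for v
    using assms(2) unfolding less3 by (elim disjE; simp add: dot4 coord_form_def)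
  show "dot 4 (coord_form j t) u = 0" using assms(3) by (simp add: d)
  show "dot 4 (coord_form j t) (\<lambda>i. diag_fields c j i u) \<noteq> 0"
    using assms(2,4) by (simp add: d diag_fields_def)
  show "dot 4 (coord_form j t) (\<lambda>i. diag_fields c k i v) = 0"
    if "k < 4" "k \<noteq> j" "dot 4 (coord_form j t) v = 0" for k v
    using that assms(2) by (auto simp: d diag_fields_def)
  show "diag_fields (c(j := (\<lambda>v. (v j - t * v 3) * c j v))) j i v
      = dot 4 (coord_form j t) v * diag_fields c j i v" for i v
    using assms(2) by (simp add: d diag_fields_def)
  show "diag_fields (c(j := (\<lambda>v. (v j - t * v 3) * c j v))) k i v = diag_fields c k i v"
    if "k \<noteq> j" for k i v
    using that by (simp add: diag_fields_def)
qed

lemma af_basis_mixed: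
  assumes "af_basis A (diag_fields c)" "\<And>i v. i < 3 \<Longrightarrow> c i v = (v i)\<^sup>2 - (v 3)\<^sup>2"
  shows "af_basis A (mixed_fields (\<lambda>_ _. 1))"
proof -
  define M :: "nat \<Rightarrow> nat \<Rightarrow> (nat \<Rightarrow> complex) \<Rightarrow> complex"
    where "M j k v = (if j = 3 \<or> k = 3 then if j = k then 1 else 0
      else if k = (j + 2) mod 3 then - 1 else 1)" for j k v
  define N :: "nat \<Rightarrow> nat \<Rightarrow> (nat \<Rightarrow> complex) \<Rightarrow> complex"
    where "N j k v = (if j = 3 \<or> k = 3 then if j = k then 1 else 0
      else if k = (j + 1) mod 3 then 0 else 1 / 2)" for j k v
  show ?thesis
  proof (rule af_basis_change[OF assms(1)])
    show "M j k \<in> polyfun 4" "N j k \<in> polyfun 4" for j k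
      unfolding M_def N_def by (rule polyfun.const)+
    show "(\<Sum>m<4. M j m v * N m k v) = (if j = k then 1 else 0)"
      "(\<Sum>m<4. N j m v * M m k v) = (if j = k then 1 else 0)" if "j < 4" "k < 4" for j k v
      using that unfolding less4 less3 sum4 by (elim disjE; simp add: M_def N_def)+
    show "mixed_fields (\<lambda>_ _. 1) j i v = (\<Sum>k<4. M j k v * diag_fields c k i v)"
      if "j < 4" "i < 4" for j i v
      using that unfolding less4 less3 sum4
      by (elim disjE; simp add: M_def diag_fields_def mixed_fields_def assms(2))
  qed
qed

text \<open>Where two of the variables are opposite, their squares agree. So two components with opposite
  signs cancel, and only the field whose two signs are equal fails to be tangent.\<close>

lemma af_basis_pair:
  assumes "af_basis A (mixed_fields s)" "j < 3" "s j = (\<lambda>_. 1)"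
  shows "af_basis (insert (form_kernel Cplx 4 (pair_form j)) A)
           (mixed_fields (s(j := (\<lambda>v. v j + v ((j + 1) mod 3)))))"
proof (rule af_basis_add[OF assms(1), of j _ "\<lambda>i. if i = j then 1 else if i = (j + 1) mod 3 then - 1 else 0"])
  let ?u = "\<lambda>i. if i = j then 1 else if i = (j + 1) mod 3 then - 1 else (0::complex)"
  show "j < 4" using assms(2) by simp
  have d: "dot 4 (pair_form j) v = v j + v ((j + 1) mod 3)" for v
    using assms(2) unfolding less3 by (elim disjE; simp add: dot4 pair_form_def del: One_nat_def)
  show "dot 4 (pair_form j) ?u = 0"
    using assms(2) unfolding d less3 by (elim disjE; simp)
  show "dot 4 (pair_form j) (\<lambda>i. mixed_fields s j i ?u) \<noteq> 0"
    using assms(2,3) unfolding d less3 by (elim disjE; simp add: mixed_fields_def)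
  show "dot 4 (pair_form j) (\<lambda>i. mixed_fields s k i v) = 0"
    if k: "k < 4" "k \<noteq> j" and v: "dot 4 (pair_form j) v = 0" for k v
  proof -
    have "v ((j + 1) mod 3) = - v j" using v unfolding d by (simp add: add_eq_0_iff)
    then show ?thesis
      using k assms(2) unfolding d less4 less3
      by (elim disjE; simp add: mixed_fields_def algebra_simps)
  qed
  show "mixed_fields (s(j := (\<lambda>v. v j + v ((j + 1) mod 3)))) j i v
      = dot 4 (pair_form j) v * mixed_fields s j i v" for i v
    using assms(2,3) by (simp add: d mixed_fields_def)
  show "mixed_fields (s(j := (\<lambda>v. v j + v ((j + 1) mod 3)))) k i v = mixed_fields s k i v"
    if "k \<noteq> j" for k i v
    using that by (simp add: mixed_fields_def)
qed

lemma additionally_free_ten: "additionally_free Cplx 4 (form_kernel Cplx 4 ` ten_forms)"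
proof -
  \<comment> \<open>points on the hyperplanes \<open>x\<^sub>j = w\<close> and \<open>x\<^sub>j = - w\<close> at which the \<open>j\<close>-th field does not vanish\<close>
  define p m :: "nat \<Rightarrow> nat \<Rightarrow> complex"
    where "p j = (\<lambda>i. if i = j \<or> i = 3 then 1 else 0)"
      and "m j = (\<lambda>i. if i = j then - 1 else if i = 3 then 1 else 0)" for j
  note basis =
    af_basis_pair[of _ _ 2, OF af_basis_pair[of _ _ 1, OF af_basis_pair[of _ _ 0, OF af_basis_mixed[OF
    af_basis_coord[of _ _ 2 "m 2" "-1", OF af_basis_coord[of _ _ 2 "p 2" 1,
    OF af_basis_coord[of _ _ 1 "m 1" "-1", OF af_basis_coord[of _ _ 1 "p 1" 1,
    OF af_basis_coord[of _ _ 0 "m 0" "-1", OF af_basis_coord[of _ _ 0 "p 0" 1,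
    OF af_basis_inf]]]]]]]]]]
  have "\<exists>b. af_basis (form_kernel Cplx 4 ` ten_forms) b"
    unfolding ten_forms_def image_insert image_empty
    by (rule exI, rule basis)
       (auto simp: p_def m_def less3 power2_eq_square algebra_simps)
  then show ?thesis unfolding af_basis_def by blast
qed

section \<open>The restriction is not free\<close>

text \<open>The restriction to \<open>w = 0\<close>, in the coordinates \<open>x, y, z\<close>: the six planes \<open>x\<close>, \<open>y\<close>, \<open>z\<close>, \<open>x + y\<close>, \<open>y + z\<close>
  and \<open>z + x\<close>. Only the form \<open>w\<close> itself has no nonzero coefficient at these coordinates.\<close>

abbreviation six_kernels :: "(nat \<Rightarrow> complex) set set" where
  "six_kernels \<equiv> form_kernel Cplx 3 ` {a \<in> ten_forms. \<exists>i<3. a i \<noteq> 0}"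

lemma dot3: "dot 3 a v = a 0 * v 0 + a 1 * v 1 + a 2 * v 2"
  by (simp add: dot_def eval_nat_numeral)

lemma dot3_forms:
  "dot 3 inf_form v = 0" "j < 3 \<Longrightarrow> dot 3 (coord_form j t) v = v j"
  "dot 3 (pair_form 0) v = v 0 + v 1" "dot 3 (pair_form 1) v = v 1 + v 2" "dot 3 (pair_form 2) v = v 2 + v 0"
  by (auto simp: dot3 form_defs less3)

lemma fields_six:
  assumes "g \<in> log_fields 3 six_kernels"
  shows "\<And>i. i < 3 \<Longrightarrow> g i \<in> polyfun 3"
    and "\<And>j v. \<lbrakk>j < 3; v j = 0\<rbrakk> \<Longrightarrow> g j v = 0"
    and "\<And>i j v. \<lbrakk>i < j; j < 3; v i + v j = 0\<rbrakk> \<Longrightarrow> g i v + g j v = 0"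
proof -
  show "g i \<in> polyfun 3" if "i < 3" for i using assms that by (simp add: log_fields_def)
  have t: "dot 3 a (\<lambda>i. g i v) = 0" if a: "a \<in> ten_forms" "\<exists>i<3. a i \<noteq> 0" and v: "dot 3 a v = 0" for a v
  proof -
    have "form_kernel Cplx 3 a \<in> six_kernels" using a by blast
    moreover have "tangent 3 six_kernels g" using assms by (simp add: log_fields_def)
    ultimately show ?thesis using v unfolding tangent_def kernel_iff[symmetric] by blast
  qed
  show "g j v = 0" if j: "j < 3" and v: "v j = 0" for j v
  proof -
    have "coord_form j 1 \<in> ten_forms" using j unfolding less3 ten_forms_def by auto
    moreover have "\<exists>i<3. coord_form j 1 i \<noteq> 0" using j by (intro exI[of _ j]) (simp add: coord_form_def)
    ultimately show ?thesis using t[of "coord_form j 1" v] j v by (simp add: dot3_forms)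
  qed
  have p: "dot 3 (pair_form j) (\<lambda>i. g i v) = 0" if "j < 3" "dot 3 (pair_form j) v = 0" for j v
  proof (rule t)
    show "pair_form j \<in> ten_forms" using that unfolding less3 ten_forms_def by auto
    show "\<exists>i<3. pair_form j i \<noteq> 0" using that by (intro exI[of _ j]) (simp add: pair_form_def)
  qed (rule that)
  show "g i v + g j v = 0" if "i < j" "j < 3" "v i + v j = 0" for i j v
  proof -
    have "i = 0 \<and> j = 1 \<or> i = 1 \<and> j = 2 \<or> i = 0 \<and> j = 2" using that(1,2) by presburger
    then consider "i = 0" "j = 1" | "i = 1" "j = 2" | "i = 0" "j = 2" by blast
    then show ?thesis
      using p[of 0 v] p[of 1 v] p[of 2 v] that(3)
      by cases (simp_all add: dot3_forms add.commute del: One_nat_def)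
  qed
qed

lemma fields_sixI:
  assumes g: "\<And>i. i < 3 \<Longrightarrow> g i \<in> polyfun 3"
    and c: "\<And>j v. \<lbrakk>j < 3; v j = 0\<rbrakk> \<Longrightarrow> g j v = 0"
    and p: "\<And>i j v. \<lbrakk>i < 3; j < 3; v i + v j = 0\<rbrakk> \<Longrightarrow> g i v + g j v = 0"
  shows "g \<in> log_fields 3 six_kernels"
proof -
  have "dot 3 a (\<lambda>i. g i v) = 0" if "a \<in> ten_forms" "dot 3 a v = 0" for a v
    using that c p unfolding ten_forms_def by (auto simp: dot3_forms simp del: One_nat_def)
  then have "tangent 3 six_kernels g"
    unfolding tangent_def by (auto simp: kernel_iff)
  then show ?thesis using g by (simp add: log_fields_def)
qed

lemma polyfun_line_cancel:
  assumes "f \<in> polyfun l" "g \<in> polyfun l" "\<And>t. f (\<lambda>i. t * d i) * g (\<lambda>i. t * d i) = 0" "f d \<noteq> 0"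
  shows "g (\<lambda>i. 0) = 0"
proof -
  let ?W = "range (\<lambda>t i. t * d i :: complex)"
  have "(\<forall>v\<in>?W. f v = 0) \<or> (\<forall>v\<in>?W. g v = 0)"
  proof (rule polyfun_no_zero_divisors[OF assms(1,2)])
    fix u w :: "nat \<Rightarrow> complex" and t
    assume "u \<in> ?W" "w \<in> ?W"
    then obtain r s where "u = (\<lambda>i. r * d i)" "w = (\<lambda>i. s * d i)" by blast
    then have "(\<lambda>i. u i + t * (w i - u i)) = (\<lambda>i. (r + t * (s - r)) * d i)"
      by (simp add: algebra_simps)
    then show "(\<lambda>i. u i + t * (w i - u i)) \<in> ?W" by simp
  qed (use assms(3) in auto)
  moreover have "d \<in> ?W" by (rule range_eqI[of _ _ 1]) simp
  moreover have "(\<lambda>i. 0) \<in> ?W" by (rule range_eqI[of _ _ 0]) simp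
  ultimately show ?thesis using assms(4) by blast
qed

text \<open>A tangent field is \<open>(x s\<^sub>0, y s\<^sub>1, z s\<^sub>2)\<close>, where \<open>s\<^sub>i\<close> and \<open>s\<^sub>j\<close> agree on the plane \<open>x\<^sub>i + x\<^sub>j = 0\<close>. The three
  sums of coordinates are linearly independent forms and the three differences add up to zero, which
  forces the quotient \<open>k\<close> of \<open>s\<^sub>0 - s\<^sub>1\<close> by \<open>x + y\<close> to vanish at the origin.\<close>

lemma fields_six_quotients:
  assumes g: "g \<in> log_fields 3 six_kernels"
  shows "\<exists>s\<^sub>0 s\<^sub>1 k. s\<^sub>0 \<in> polyfun 3 \<and> s\<^sub>1 \<in> polyfun 3 \<and> k \<in> polyfun 3 \<and>
    (\<forall>v. g 0 v = v 0 * s\<^sub>0 v) \<and> (\<forall>v. g 1 v = v 1 * s\<^sub>1 v) \<and>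
    (\<forall>v. s\<^sub>0 v - s\<^sub>1 v = (v 0 + v 1) * k v) \<and> k (\<lambda>i. 0) = 0"
proof -
  note gp = fields_six[OF g]
  have "\<exists>s. s \<in> polyfun 3 \<and> (\<forall>v. g i v = v i * s v)" if i: "i < 3" for i
  proof -
    obtain s where "s \<in> polyfun 3" "\<And>v. g i v = dot 3 (coord_form i 0) v * s v"
      using polyfun_dvd[where a="coord_form i 0" and j=i, OF gp(1)[OF i] i] gp(2)[OF i] i
      by (auto simp: dot3_forms) (auto simp: coord_form_def)
    then show ?thesis using i by (auto simp: dot3_forms)
  qed
  then obtain s where s: "\<And>i. i < 3 \<Longrightarrow> s i \<in> polyfun 3" "\<And>i v. i < 3 \<Longrightarrow> g i v = v i * s i v"
    by metis
  have eq: "s i v = s j v" if ij: "i < j" "j < 3" and v: "v i + v j = 0" for i j v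
  proof -
    let ?W = "{v :: nat \<Rightarrow> complex. v i + v j = 0}"
    have "u i * (s i u - s j u) = 0" if u: "u i + u j = 0" for u
    proof -
      have "u j = - u i" using u by (simp add: add_eq_0_iff)
      then have "g i u + g j u = u i * (s i u - s j u)"
        using s(2)[of i u] s(2)[of j u] ij by (simp add: algebra_simps)
      then show ?thesis using gp(3)[OF ij u] by simp
    qed
    then have "(\<forall>v\<in>?W. v i = 0) \<or> (\<forall>v\<in>?W. s i v - s j v = 0)"
      using ij s(1)
      by (intro polyfun_no_zero_divisors[of _ 3] polyfun_intros) (auto simp: algebra_simps add_eq_0_iff)
    moreover have "\<not> (\<forall>v\<in>?W. v i = 0)"
    proof
      assume 0: "\<forall>v\<in>?W. v i = 0"
      have "(\<lambda>n. if n = i then 1 else if n = j then - 1 else 0) \<in> ?W" using ij by simp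
      from bspec[OF 0 this] show False by simp
    qed
    ultimately have "\<forall>v\<in>?W. s i v - s j v = 0" by blast
    then show ?thesis using v by simp
  qed
  have sp: "(\<lambda>v. s 0 v - s 1 v) \<in> polyfun 3" using s(1) by (intro polyfun_diff) auto
  obtain k where k: "k \<in> polyfun 3" "\<And>v. s 0 v - s 1 v = dot 3 (pair_form 0) v * k v"
  proof (rule polyfun_dvd[OF sp, of 0 "pair_form 0"])
    show "s 0 v - s 1 v = 0" if "dot 3 (pair_form 0) v = 0" for v
      using eq[of 0 1 v] that by (simp add: dot3_forms)
  qed (auto simp: pair_form_def)
  have k2: "s 0 v - s 1 v = (v 0 + v 1) * k v" for v using k(2) by (simp only: dot3_forms)
  \<comment> \<open>On the line where both other sums of coordinates vanish, all three quotients agree.\<close>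
  have "k (\<lambda>i. 0) = 0"
  proof (rule polyfun_line_cancel[where f="\<lambda>v. v 0 + v 1" and l=3 and d="\<lambda>i. if i = 2 then - 1 else 1"])
    show "(\<lambda>v. v 0 + v 1) \<in> polyfun 3" by (intro polyfun_intros) auto
    fix t :: complex
    let ?v = "\<lambda>i::nat. t * (if i = 2 then - 1 else 1)"
    have "s 0 ?v = s 2 ?v" "s 1 ?v = s 2 ?v" by (rule eq; simp)+
    then have "s 0 ?v - s 1 ?v = 0" by simp
    then show "(?v 0 + ?v 1) * k ?v = 0" unfolding k2 .
  qed (use k(1) in simp_all)
  then show ?thesis
    using s k(1) k2 by (intro exI[of _ "s 0"] exI[of _ "s 1"] exI[of _ k]) auto
qed

lemma field_basis_coords:
  assumes b: "field_basis l A J b" and g: "g \<in> log_fields l A"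
  shows "\<exists>F c. finite F \<and> F \<subseteq> J \<and> (\<forall>j. c j \<in> polyfun l) \<and>
    (\<forall>G. finite G \<longrightarrow> F \<subseteq> G \<longrightarrow> (\<forall>i<l. \<forall>v. g i v = (\<Sum>j\<in>G. c j v * b j i v)))"
proof -
  obtain F c where F: "finite F" "F \<subseteq> J" and c: "\<forall>k\<in>F. c k \<in> polyfun l"
    and gc: "\<forall>i<l. \<forall>v. g i v = (\<Sum>k\<in>F. c k v * b k i v)"
    using field_basis_span[OF b g] by (elim exE conjE)
  define d where "d k = (if k \<in> F then c k else (\<lambda>_. 0))" for k
  have "d k \<in> polyfun l" for k using c by (auto simp: d_def polyfun.const)
  moreover have "g i v = (\<Sum>j\<in>G. d j v * b j i v)" if "finite G" "F \<subseteq> G" "i < l" for G i v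
  proof -
    have "(\<Sum>j\<in>G. d j v * b j i v) = (\<Sum>j\<in>F. d j v * b j i v)"
      using that by (intro sum.mono_neutral_right) (auto simp: d_def)
    also have "\<dots> = g i v" using gc that by (simp add: d_def)
    finally show ?thesis ..
  qed
  ultimately show ?thesis using F by (intro exI[of _ F] exI[of _ d]) simp
qed

text \<open>With \<open>p = x + y\<close>, \<open>q = y + z\<close> and \<open>r = z + x\<close> these are \<open>(x p r, 0, 0)\<close>, \<open>(0, y p q, 0)\<close> and \<open>(0, 0, z q r)\<close>.
  They correspond to the Koszul syzygies of \<open>p, q, r\<close>.\<close>

definition koszul_field :: "nat \<Rightarrow> nat \<Rightarrow> (nat \<Rightarrow> complex) \<Rightarrow> complex" where
  "koszul_field j i v = (if i = j then v j * (\<Prod>n\<in>{..<3} - {j}. v j + v n) else 0)"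

text \<open>The Koszul fields \<open>e\<^sub>0, e\<^sub>1, e\<^sub>2\<close> and the Euler field \<open>E\<close> satisfy \<open>q e\<^sub>0 + r e\<^sub>1 + p e\<^sub>2 = p q r E\<close>. In a basis
  the same relation holds between the coefficients. Its right-hand side has order three at the origin
  and \<open>p, q, r\<close> are independent, so the coefficients of \<open>e\<^sub>0\<close> vanish at the origin. Comparing the first
  two components of \<open>e\<^sub>0\<close> with those of its expansion shows that \<open>r\<close> is the sum of the products of these
  coefficients with the functions \<open>k\<close> of the basis fields. These vanish at the origin as well, but a sum
  of such products has no linear part.\<close>

lemma six_not_free: "\<not> free_arrangement Cplx 3 six_kernels"
proof
  assume "free_arrangement Cplx 3 six_kernels"
  then obtain J where b: "field_basis 3 six_kernels J comps"
    using free_imp_field_basis by blast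
  have E: "(\<lambda>i v. v i) \<in> log_fields 3 six_kernels"
    by (rule fields_sixI) (auto intro: polyfun_var)
  have e: "koszul_field j \<in> log_fields 3 six_kernels" if j: "j < 3" for j
  proof (rule fields_sixI)
    have "koszul_field j i = (if i = j then (\<lambda>v. v j * (\<Prod>n\<in>{..<3} - {j}. v j + v n)) else (\<lambda>_. 0))" for i
      by (auto simp: koszul_field_def)
    then show "koszul_field j i \<in> polyfun 3" if "i < 3" for i
      using that by (auto intro!: polyfun_intros)
    have 0: "koszul_field j j v = 0" if "i < 3" "i \<noteq> j" "v i + v j = 0" for i v
    proof -
      have "(\<Prod>n\<in>{..<3} - {j}. v j + v n) = 0"
        using that by (intro prod_zero) (auto simp: add.commute intro!: bexI[of _ i])
      then show ?thesis by (simp add: koszul_field_def)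
    qed
    show "koszul_field j i v + koszul_field j k v = 0" if "i < 3" "k < 3" "v i + v k = 0" for i k v
      using that 0[of i v] 0[of k v]
      by (cases "i = j"; cases "k = j") (auto simp: koszul_field_def add.commute)
  qed (auto simp: koszul_field_def)
  have e0: "koszul_field 0 \<in> log_fields 3 six_kernels" and e1: "koszul_field 1 \<in> log_fields 3 six_kernels"
    and e2: "koszul_field 2 \<in> log_fields 3 six_kernels" by (rule e; simp)+
  obtain F\<^sub>E c\<^sub>E where FE: "finite F\<^sub>E" "F\<^sub>E \<subseteq> J" and cE: "\<forall>\<beta>. c\<^sub>E \<beta> \<in> polyfun 3"
    and sE: "\<forall>G. finite G \<longrightarrow> F\<^sub>E \<subseteq> G \<longrightarrow> (\<forall>i<3. \<forall>v. v i = (\<Sum>\<beta>\<in>G. c\<^sub>E \<beta> v * comps \<beta> i v))"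
    using field_basis_coords[OF b E] by (elim exE conjE)
  obtain F\<^sub>0 c\<^sub>0 where F0: "finite F\<^sub>0" "F\<^sub>0 \<subseteq> J" and c0: "\<forall>\<beta>. c\<^sub>0 \<beta> \<in> polyfun 3"
    and s0: "\<forall>G. finite G \<longrightarrow> F\<^sub>0 \<subseteq> G \<longrightarrow> (\<forall>i<3. \<forall>v. koszul_field 0 i v = (\<Sum>\<beta>\<in>G. c\<^sub>0 \<beta> v * comps \<beta> i v))"
    using field_basis_coords[OF b e0] by (elim exE conjE)
  obtain F\<^sub>1 c\<^sub>1 where F1: "finite F\<^sub>1" "F\<^sub>1 \<subseteq> J" and c1: "\<forall>\<beta>. c\<^sub>1 \<beta> \<in> polyfun 3"
    and s1: "\<forall>G. finite G \<longrightarrow> F\<^sub>1 \<subseteq> G \<longrightarrow> (\<forall>i<3. \<forall>v. koszul_field 1 i v = (\<Sum>\<beta>\<in>G. c\<^sub>1 \<beta> v * comps \<beta> i v))"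
    using field_basis_coords[OF b e1] by (elim exE conjE)
  obtain F\<^sub>2 c\<^sub>2 where F2: "finite F\<^sub>2" "F\<^sub>2 \<subseteq> J" and c2: "\<forall>\<beta>. c\<^sub>2 \<beta> \<in> polyfun 3"
    and s2: "\<forall>G. finite G \<longrightarrow> F\<^sub>2 \<subseteq> G \<longrightarrow> (\<forall>i<3. \<forall>v. koszul_field 2 i v = (\<Sum>\<beta>\<in>G. c\<^sub>2 \<beta> v * comps \<beta> i v))"
    using field_basis_coords[OF b e2] by (elim exE conjE)
  define G where "G = F\<^sub>E \<union> F\<^sub>0 \<union> F\<^sub>1 \<union> F\<^sub>2"
  have G: "finite G" "G \<subseteq> J" and sub: "F\<^sub>E \<subseteq> G" "F\<^sub>0 \<subseteq> G" "F\<^sub>1 \<subseteq> G" "F\<^sub>2 \<subseteq> G"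
    using FE F0 F1 F2 by (auto simp: G_def)
  note sE = sE[rule_format, OF G(1) sub(1)] and s0 = s0[rule_format, OF G(1) sub(2)]
    and s1 = s1[rule_format, OF G(1) sub(3)] and s2 = s2[rule_format, OF G(1) sub(4)]
  let ?p = "\<lambda>v::nat \<Rightarrow> complex. v 0 + v 1" and ?q = "\<lambda>v::nat \<Rightarrow> complex. v 1 + v 2"
    and ?r = "\<lambda>v::nat \<Rightarrow> complex. v 2 + v 0"
  have pqr: "?p \<in> polyfun 3" "?q \<in> polyfun 3" "?r \<in> polyfun 3" by (auto intro!: polyfun_intros)
  have eval: "koszul_field 0 0 v = v 0 * (?p v * ?r v)" "koszul_field 1 1 v = v 1 * (?p v * ?q v)"
    "koszul_field 2 2 v = v 2 * (?r v * ?q v)" for v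
  proof -
    have "{..<3} - {0} = {1, 2::nat}" "{..<3} - {1} = {0, 2::nat}" "{..<3} - {2} = {0, 1::nat}" by auto
    then show "koszul_field 0 0 v = v 0 * (?p v * ?r v)" "koszul_field 1 1 v = v 1 * (?p v * ?q v)"
      "koszul_field 2 2 v = v 2 * (?r v * ?q v)"
      by (simp_all add: koszul_field_def add.commute del: One_nat_def)
  qed
  have off: "koszul_field j i v = 0" if "i \<noteq> j" for i j v using that by (simp add: koszul_field_def)
  have rel: "?q v * c\<^sub>0 \<beta> v + ?r v * c\<^sub>1 \<beta> v + ?p v * c\<^sub>2 \<beta> v - ?p v * ?q v * ?r v * c\<^sub>E \<beta> v = 0"
    if \<beta>: "\<beta> \<in> G" for \<beta> v
  proof (rule field_basis_indep[where c="\<lambda>\<beta> v. ?q v * c\<^sub>0 \<beta> v + ?r v * c\<^sub>1 \<beta> v + ?p v * c\<^sub>2 \<beta> v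
        - ?p v * ?q v * ?r v * c\<^sub>E \<beta> v", OF b G(1,2) _ _ \<beta>])
    show "(\<lambda>v. ?q v * c\<^sub>0 \<beta> v + ?r v * c\<^sub>1 \<beta> v + ?p v * c\<^sub>2 \<beta> v - ?p v * ?q v * ?r v * c\<^sub>E \<beta> v)
        \<in> polyfun 3" for \<beta>
      using c0 c1 c2 cE pqr by (intro polyfun.add polyfun_diff polyfun_mult polyfun_var) auto
    fix i v assume i: "i < (3::nat)"
    have "(\<Sum>\<beta>\<in>G. (?q v * c\<^sub>0 \<beta> v + ?r v * c\<^sub>1 \<beta> v + ?p v * c\<^sub>2 \<beta> v - ?p v * ?q v * ?r v * c\<^sub>E \<beta> v)
          * comps \<beta> i v)
        = ?q v * (\<Sum>\<beta>\<in>G. c\<^sub>0 \<beta> v * comps \<beta> i v) + ?r v * (\<Sum>\<beta>\<in>G. c\<^sub>1 \<beta> v * comps \<beta> i v)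
          + ?p v * (\<Sum>\<beta>\<in>G. c\<^sub>2 \<beta> v * comps \<beta> i v)
          - ?p v * ?q v * ?r v * (\<Sum>\<beta>\<in>G. c\<^sub>E \<beta> v * comps \<beta> i v)"
      unfolding sum_distrib_left sum.distrib[symmetric] sum_subtractf[symmetric]
      by (intro sum.cong refl) (simp only: algebra_simps)
    also have "\<dots> = ?q v * koszul_field 0 i v + ?r v * koszul_field 1 i v + ?p v * koszul_field 2 i v
        - ?p v * ?q v * ?r v * v i"
      unfolding s0[OF i, symmetric] s1[OF i, symmetric] s2[OF i, symmetric] sE[OF i, symmetric] by (rule refl)
    also have "\<dots> = 0"
      using i unfolding less3 by (elim disjE) (simp_all add: eval off del: One_nat_def)
    finally show "(\<Sum>\<beta>\<in>G. (?q v * c\<^sub>0 \<beta> v + ?r v * c\<^sub>1 \<beta> v + ?p v * c\<^sub>2 \<beta> v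
        - ?p v * ?q v * ?r v * c\<^sub>E \<beta> v) * comps \<beta> i v) = 0" .
  qed
  \<comment> \<open>on the line spanned by \<open>(-1, 1, 1)\<close> both \<open>p\<close> and \<open>r\<close> vanish, but \<open>q\<close> does not\<close>
  have c00: "c\<^sub>0 \<beta> (\<lambda>i. 0) = 0" if \<beta>: "\<beta> \<in> G" for \<beta>
  proof (rule polyfun_line_cancel[where f="?q" and l=3 and d="\<lambda>i. if i = 0 then - 1 else 1"])
    fix t :: complex
    show "?q (\<lambda>i. t * (if i = 0 then - 1 else 1)) * c\<^sub>0 \<beta> (\<lambda>i. t * (if i = 0 then - 1 else 1)) = 0"
      using rel[OF \<beta>, of "\<lambda>i. t * (if i = 0 then - 1 else 1)"] by simp
  qed (use pqr c0 in simp_all)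
  have "\<forall>\<beta>\<in>G. \<exists>s\<^sub>0 s\<^sub>1 k. s\<^sub>0 \<in> polyfun 3 \<and> s\<^sub>1 \<in> polyfun 3 \<and> k \<in> polyfun 3 \<and>
    (\<forall>v. comps \<beta> 0 v = v 0 * s\<^sub>0 v) \<and> (\<forall>v. comps \<beta> 1 v = v 1 * s\<^sub>1 v) \<and>
    (\<forall>v. s\<^sub>0 v - s\<^sub>1 v = (v 0 + v 1) * k v) \<and> k (\<lambda>i. 0) = 0"
    using fields_six_quotients field_basis_field[OF b] G(2) by blast
  then obtain s\<^sub>0 s\<^sub>1 k where sp: "\<And>\<beta>. \<beta> \<in> G \<Longrightarrow> s\<^sub>0 \<beta> \<in> polyfun 3" "\<And>\<beta>. \<beta> \<in> G \<Longrightarrow> s\<^sub>1 \<beta> \<in> polyfun 3"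
      "\<And>\<beta>. \<beta> \<in> G \<Longrightarrow> k \<beta> \<in> polyfun 3"
    and sv: "\<And>\<beta> v. \<beta> \<in> G \<Longrightarrow> comps \<beta> 0 v = v 0 * s\<^sub>0 \<beta> v" "\<And>\<beta> v. \<beta> \<in> G \<Longrightarrow> comps \<beta> 1 v = v 1 * s\<^sub>1 \<beta> v"
      "\<And>\<beta> v. \<beta> \<in> G \<Longrightarrow> s\<^sub>0 \<beta> v - s\<^sub>1 \<beta> v = ?p v * k \<beta> v"
    and k0: "\<And>\<beta>. \<beta> \<in> G \<Longrightarrow> k \<beta> (\<lambda>i. 0) = 0"
    unfolding bchoice_iff by blast
  let ?S\<^sub>0 = "\<lambda>v. \<Sum>\<beta>\<in>G. c\<^sub>0 \<beta> v * s\<^sub>0 \<beta> v" and ?S\<^sub>1 = "\<lambda>v. \<Sum>\<beta>\<in>G. c\<^sub>0 \<beta> v * s\<^sub>1 \<beta> v"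
    and ?K = "\<lambda>v. \<Sum>\<beta>\<in>G. c\<^sub>0 \<beta> v * k \<beta> v"
  have Sp: "?S\<^sub>0 \<in> polyfun 3" "?S\<^sub>1 \<in> polyfun 3" "?K \<in> polyfun 3"
    using c0 sp by (auto intro!: polyfun_sum polyfun_mult)
  have S0: "?S\<^sub>0 v - ?p v * ?r v = 0" for v
  proof (rule polyfun_cancel[where f="\<lambda>v. v 0" and g="\<lambda>v. ?S\<^sub>0 v - ?p v * ?r v" and l=3 and u="\<lambda>_. 1"])
    show "v 0 * (?S\<^sub>0 v - ?p v * ?r v) = 0" for v
      using s0[of 0 v] sv(1) eval(1)[of v]
      by (simp add: right_diff_distrib sum_distrib_left mult.left_commute cong: sum.cong)
  qed (use Sp pqr in \<open>auto intro!: polyfun_intros\<close>)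
  have S1: "?S\<^sub>1 v = 0" for v
  proof (rule polyfun_cancel[where f="\<lambda>v. v 1" and g="?S\<^sub>1" and l=3 and u="\<lambda>_. 1"])
    show "v 1 * ?S\<^sub>1 v = 0" for v
      using s0[of 1 v] sv(2) off[of 1 0 v]
      by (simp add: sum_distrib_left mult.left_commute cong: sum.cong)
  qed (use Sp in \<open>auto intro!: polyfun_intros\<close>)
  have K: "?K v - ?r v = 0" for v
  proof (rule polyfun_cancel[where f="?p" and g="\<lambda>v. ?K v - ?r v" and l=3 and u="\<lambda>_. 1"])
    fix v
    have "?p v * ?K v = (\<Sum>\<beta>\<in>G. c\<^sub>0 \<beta> v * (s\<^sub>0 \<beta> v - s\<^sub>1 \<beta> v))"
      using sv(3) by (simp add: sum_distrib_left mult_ac cong: sum.cong)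
    also have "\<dots> = ?S\<^sub>0 v - ?S\<^sub>1 v" by (simp add: right_diff_distrib sum_subtractf)
    also have "\<dots> = ?p v * ?r v" using S0[of v] S1[of v] by simp
    finally show "?p v * (?K v - ?r v) = 0" by (simp add: right_diff_distrib)
  qed (use Sp pqr in \<open>auto intro!: polyfun_intros\<close>)
  \<comment> \<open>both factors of each summand of \<open>?K\<close> vanish at the origin, so its derivative there is zero\<close>
  let ?w = "\<lambda>i::nat. if i = 0 then 1 else (0::complex)"
  have "has_dir_deriv ?K (\<Sum>\<beta>\<in>G. 0) (\<lambda>i. 0) ?w"
  proof (rule has_dir_deriv_sum)
    fix \<beta> assume \<beta>: "\<beta> \<in> G"
    have w: "(\<lambda>v. ?w i) \<in> polyfun 3" for i by (rule polyfun.const)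
    obtain d e where "has_dir_deriv (c\<^sub>0 \<beta>) d (\<lambda>i. 0) ?w" "has_dir_deriv (k \<beta>) e (\<lambda>i. 0) ?w"
      using polyfun_dir_deriv[where g="\<lambda>i v. ?w i", OF c0[rule_format, of \<beta>] w]
        polyfun_dir_deriv[where g="\<lambda>i v. ?w i", OF sp(3)[OF \<beta>] w] by auto
    from has_dir_deriv_mult[OF this] show "has_dir_deriv (\<lambda>v. c\<^sub>0 \<beta> v * k \<beta> v) 0 (\<lambda>i. 0) ?w"
      using c00[OF \<beta>] k0[OF \<beta>] by simp
  qed
  moreover have "?K = ?r" using K by (simp add: fun_eq_iff)
  ultimately have "has_dir_deriv ?r 0 (\<lambda>i. 0) ?w" by simp
  moreover have "has_dir_deriv ?r (0 + 1) (\<lambda>i. 0) ?w"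
    using has_dir_deriv_add[OF has_dir_deriv_var[of 2 ?w] has_dir_deriv_var[of 0 ?w], of "\<lambda>i. 0"] by simp
  ultimately have "0 = 0 + (1 :: complex)" by (rule has_dir_deriv_unique)
  then show False by simp
qed

section \<open>The restriction in coordinates\<close>

abbreviation wall :: "(nat \<Rightarrow> complex) set" where
  "wall \<equiv> form_kernel Cplx 4 inf_form"

definition wall_param :: "(nat \<Rightarrow> complex) \<Rightarrow> nat \<Rightarrow> complex" where
  "wall_param v = (\<lambda>i\<in>{..<4}. if i < 3 then v i else 0)"

lemma wall_param_kernel: "wall_param v \<in> form_kernel Cplx 4 a \<longleftrightarrow> dot 3 a v = 0"
  unfolding wall_param_def kernel_iff by (simp add: dot4 dot3)

lemma wall_param_wall: "wall_param v \<in> wall"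
  by (simp add: wall_param_kernel dot3_forms)

lemma wall_subset: "wall \<subseteq> form_kernel Cplx 4 a \<longleftrightarrow> (\<forall>i<3. a i = 0)"
proof
  assume w: "wall \<subseteq> form_kernel Cplx 4 a"
  have "dot 3 a v = 0" for v using w wall_param_wall[of v] wall_param_kernel by blast
  from this[of "\<lambda>i. if i = 0 then 1 else 0"] this[of "\<lambda>i. if i = 1 then 1 else 0"]
    this[of "\<lambda>i. if i = 2 then 1 else 0"]
  show "\<forall>i<3. a i = 0" by (simp add: dot3 less3)
next
  assume "\<forall>i<3. a i = 0"
  then show "wall \<subseteq> form_kernel Cplx 4 a" by (auto simp: kernel_mem dot4 inf_form_def)
qed

lemma linear_coords_wall_param: "linear_coords Cplx 4 wall 3 wall_param"
  unfolding linear_coords_def Let_def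
proof (intro conjI ballI)
  show "bij_betw wall_param (carrier (coord_space Cplx 3)) wall"
  proof (rule bij_betw_byWitness[where f'="\<lambda>w. restrict w {..<3}"])
    show "\<forall>v\<in>carrier (coord_space Cplx 3). restrict (wall_param v) {..<3} = v"
    proof
      fix v :: "nat \<Rightarrow> complex" assume "v \<in> carrier (coord_space Cplx 3)"
      then have "v = restrict v {..<3}" by (simp add: coord_carrier)
      moreover have "restrict (wall_param v) {..<3} = restrict v {..<3}"
        by (rule restrict_ext) (simp add: wall_param_def)
      ultimately show "restrict (wall_param v) {..<3} = v" by simp
    qed
    show "\<forall>w\<in>wall. wall_param (restrict w {..<3}) = w"
    proof
      fix w assume w: "w \<in> wall"
      then have r: "restrict w {..<4} = w" and "w 3 = 0"
        by (auto simp: kernel_mem dot4 inf_form_def)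
      then have "wall_param (restrict w {..<3}) = restrict w {..<4}"
        unfolding wall_param_def by (intro restrict_ext) (auto simp: less4)
      then show "wall_param (restrict w {..<3}) = w" using r by simp
    qed
    show "wall_param ` carrier (coord_space Cplx 3) \<subseteq> wall" using wall_param_wall by blast
    show "(\<lambda>w. restrict w {..<3}) ` wall \<subseteq> carrier (coord_space Cplx 3)"
      by (auto simp: coord_carrier)
  qed
qed (auto simp: coord_space_def wall_param_def fun_eq_iff)

lemma in_coords_restriction:
  "in_coords Cplx 3 wall_param (restriction (form_kernel Cplx 4 ` B) wall)
    = form_kernel Cplx 3 ` {a \<in> B. \<exists>i<3. a i \<noteq> 0}"
proof -
  have eq: "{v \<in> carrier (coord_space Cplx 3). wall_param v \<in> wall \<inter> form_kernel Cplx 4 a}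
      = form_kernel Cplx 3 a" for a
  proof -
    have "{v \<in> carrier (coord_space Cplx 3). wall_param v \<in> wall \<inter> form_kernel Cplx 4 a}
        = {v. restrict v {..<3} = v \<and> dot 3 a v = 0}"
      by (simp add: wall_param_kernel coord_carrier dot3_forms)
    then show ?thesis by (simp add: set_eq_iff kernel_mem)
  qed
  have "form_kernel Cplx 4 ` B - localization (form_kernel Cplx 4 ` B) wall
      = form_kernel Cplx 4 ` {a \<in> B. \<not> wall \<subseteq> form_kernel Cplx 4 a}"
    unfolding localization_def by blast
  also have "\<dots> = form_kernel Cplx 4 ` {a \<in> B. \<exists>i<3. a i \<noteq> 0}"
    by (simp add: wall_subset)
  finally have "form_kernel Cplx 4 ` B - localization (form_kernel Cplx 4 ` B) wall
      = form_kernel Cplx 4 ` {a \<in> B. \<exists>i<3. a i \<noteq> 0}" .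
  then show ?thesis
    by (simp only: in_coords_def restriction_def setcompr_eq_image Collect_mem_eq image_image eq)
qed

theorem mainTheorem2:
  shows "\<exists>(K :: complex ring) (l :: nat) (A :: (nat \<Rightarrow> complex) set set) (Y :: (nat \<Rightarrow> complex) set).
           field K \<and> additionally_free K l A \<and> Y \<in> intersection_lattice K l A \<and>
           \<not> additionally_free_on K l Y (restriction A Y)"
proof (intro exI conjI)
  let ?A = "form_kernel Cplx 4 ` ten_forms"
  show "field Cplx" by (rule field_Cplx)
  show "additionally_free Cplx 4 ?A" by (rule additionally_free_ten)
  have "wall \<in> ?A" by (simp add: ten_forms_def)
  moreover have "wall \<subseteq> carrier (coord_space Cplx 4)" by (auto simp: kernel_mem coord_carrier)
  ultimately show "wall \<in> intersection_lattice Cplx 4 ?A"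
    unfolding intersection_lattice_def by (intro CollectI exI[of _ "{wall}"]) auto
  show "\<not> additionally_free_on Cplx 4 wall (restriction ?A wall)"
  proof
    assume "additionally_free_on Cplx 4 wall (restriction ?A wall)"
    from this[unfolded additionally_free_on_def, rule_format, OF linear_coords_wall_param]
    have "additionally_free Cplx 3 six_kernels" by (simp only: in_coords_restriction)
    then obtain F where F: "F (card six_kernels) = six_kernels"
      "\<forall>i\<le>card six_kernels. free_arrangement Cplx 3 (F i) \<and> card (F i) = i"
      unfolding additionally_free_def by (elim conjE exE)
    then have "free_arrangement Cplx 3 (F (card six_kernels))" by blast
    then have "free_arrangement Cplx 3 six_kernels" by (simp only: F(1))
    then show False using six_not_free by contradiction
  qed
qed

end
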